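(* For a positive integer $n$, let $M(n)$ denote the number of $\psi$-amicable pairs $(a,b)$ with $a<b$ and $a\leq n$. Then $M(n)=o(n)$ as $n\to\infty$, i.e. $\lim_{n\to\infty} M(n)/n=0$.
   Context: The Dedekind function $\psi$ is defined on positive integers by $\psi(1)=1$ and, for $n>1$ with prime factorization $n=p_1^{a_1}\cdots p_r^{a_r}$, by $\psi(n)=n\prod_{i=1}^{r}\left(1+\frac{1}{p_i}\right)$. Two different positive integers $a$ and $b$ are said to be $\psi$-amicable (and form a $\psi$-amicable pair) if $\psi(a)=\psi(b)=a+b$. *)

theory Defs
  imports Complex_Main "HOL-Computational_Algebra.Primes"
begin

text \<open>
  The product ranges over the distinct primes dividing \<open>n\<close>; it is empty for \<open>n = 1\<close>,
  so \<open>dedekind_psi 1 = 1\<close>. The value at \<open>0\<close>, where the function is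
  mathematically undefined, is never used.
\<close>

definition dedekind_psi :: "nat \<Rightarrow> real" where
  "dedekind_psi n = real n * (\<Prod>p\<in>prime_factors n. 1 + 1 / real p)"

definition psi_amicable :: "nat \<Rightarrow> nat \<Rightarrow> bool" where
  "psi_amicable a b \<longleftrightarrow>
     a > 0 \<and> b > 0 \<and> a \<noteq> b \<and>
     dedekind_psi a = real (a + b) \<and> dedekind_psi b = real (a + b)"

definition psi_amicable_count :: "nat \<Rightarrow> nat" where
  "psi_amicable_count n = card {(a, b). psi_amicable a b \<and> a < b \<and> a \<le> n}"

text \<open>
  The smaller member determines the larger one, so the counted set is finite although \<open>b\<close>
  is not explicitly bounded, and \<^const>\<open>card\<close> is the genuine number of pairs.
\<close>

lemma finite_psi_amicable_pairs:
  "finite {(a, b). psi_amicable a b \<and> a < b \<and> a \<le> n}"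
proof -
  have "inj_on fst {(a, b). psi_amicable a b \<and> a < b \<and> a \<le> n}"
    by (auto simp: inj_on_def psi_amicable_def)
  moreover have "fst ` {(a, b). psi_amicable a b \<and> a < b \<and> a \<le> n} \<subseteq> {..n}"
    by auto
  ultimately show ?thesis
    by (meson finite_atMost inj_on_finite)
qed

end

theory Submission
  imports Defs "HOL-Analysis.Analysis" "HOL-Number_Theory.Number_Theory"
begin

text \<open>
  Write \<open>f n = \<psi>(n) / n\<close>, the product of \<open>1 + 1/p\<close> over the primes \<open>p\<close> dividing \<open>n\<close>. If \<open>a < b\<close> are
  \<open>\<psi>\<close>-amicable, then \<open>f a = (a + b) / a > 2\<close> and \<open>f b = (a + b) / b < 2\<close>. The proof follows
  Erdos's argument for ordinary amicable numbers: for almost all \<open>a\<close>, the number \<open>b = \<psi>(a) - a\<close>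
  inherits the small prime factors of \<open>a\<close>, so \<open>f b\<close> cannot be much smaller than \<open>f a\<close>. Both
  values are then squeezed against 2, and \<open>f\<close> is rarely that close to a prescribed number.

  Inheritance of small primes. If a prime \<open>q\<close> divides \<open>a\<close>, then \<open>q + 1\<close> divides \<open>\<psi>(a)\<close>. So as soon as
  \<open>a\<close> has a prime factor \<open>q \<equiv> -1 (mod p)\<close>, we get \<open>p dvd \<psi>(a)\<close>, and \<open>p dvd a\<close> implies \<open>p dvd b\<close>
  (\<open>psi_amicable_dvd_transfer\<close>). The integers without such a prime factor have density zero,
  because the reciprocals of the primes \<open>q \<equiv> -1 (mod p)\<close> have a divergent sum
  (\<open>sum_inverse_primes_minus_one_mod\<close>, \<open>density_zero_sifted\<close>). This applies to all \<open>p \<le> y\<close> at once.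
  The primes above \<open>y\<close> contribute little to \<open>f a\<close> for most \<open>a\<close>, by averaging
  (\<open>card_large_prime_tail_le\<close>). Hence an amicable \<open>a\<close> outside a set of small density
  satisfies \<open>2 < f a < 2 (1 + \<delta>)\<close>.

  Continuity of the distribution of \<open>f\<close>. For \<open>\<delta>\<close> small in terms of a finite set of primes above
  \<open>z\<close>, dividing \<open>a\<close> by one of these primes is an injective map on most of the set
  \<open>{a. 2 < f a < 2 (1 + \<delta>)}\<close>, because different primes change \<open>f\<close> by clearly different factors;
  its image lies below \<open>n / z\<close> (\<open>psi_ratio_continuous_distribution\<close>).

  The case of Dirichlet's theorem that is used here is proved with real \<open>s > 1\<close> and with the
  absolute values of the L-functions only. The Euler product gives \<open>\<bar>L(s, \<chi>)\<bar>\<close>, up to a bounded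
  factor, as the exponential of the sum of \<open>Re (\<chi> q) q\<^sup>-\<^sup>s\<close> over the primes \<open>q\<close>
  (\<open>dirichlet_L_prime_sum\<close>). Summing these exponents with the signs \<open>\<chi>(-1)\<close> over the characters
  modulo \<open>p\<close> isolates the class of -1. As \<open>s\<close> tends to 1, the principal character contributes an
  unbounded amount and all others stay bounded, provided that \<open>L(1, \<chi>) \<noteq> 0\<close> (\<open>L1_nonzero\<close>). A
  non-real \<open>\<chi>\<close> with \<open>L(1, \<chi>) = 0\<close> would produce, with its conjugate, a double zero against the
  simple pole of the principal character; for real \<open>\<chi>\<close> a Lambert series argument of Monsky is used
  (\<open>real_character_L1_nonzero\<close>).
\<close>

section \<open>Multiples and inverse squares\<close>

lemma multiples_eq:
  fixes d N :: nat assumes "d > 0"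
  shows "{m \<in> {1..N}. d dvd m} = (\<lambda>k. d * k) ` {1..N div d}"
proof (intro equalityI subsetI)
  fix a assume "a \<in> {a\<in>{1..N}. d dvd a}"
  then obtain k where k: "a = d * k" "1 \<le> a" "a \<le> N" by auto
  hence "k \<le> N div d" using assms by (metis div_le_mono nonzero_mult_div_cancel_left not_gr0)
  moreover have "k \<ge> 1" using k by (cases k) auto
  ultimately show "a \<in> (\<lambda>k. d * k) ` {1..N div d}" using k(1) by auto
next
  fix a assume "a \<in> (\<lambda>k. d * k) ` {1..N div d}"
  then obtain k where k': "a = d * k" "k \<in> {1..N div d}" by (rule imageE)
  hence k: "a = d * k" "1 \<le> k" "k \<le> N div d" by simp_all
  have "d * k \<le> d * (N div d)" using k(3) by simp
  also have "\<dots> \<le> N" by simp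
  finally show "a \<in> {a\<in>{1..N}. d dvd a}" using k assms by simp
qed

lemma card_multiples_le:
  fixes d n :: nat assumes "d > 0"
  shows "real (card {a\<in>{1..n}. d dvd a}) \<le> real n / real d"
proof -
  have "inj_on (\<lambda>k. d * k) {1..n div d}" using assms by (simp add: inj_on_def)
  hence "card {a\<in>{1..n}. d dvd a} = n div d" unfolding multiples_eq[OF assms] by (simp add: card_image)
  thus ?thesis by (simp only: of_nat_div_le_of_nat)
qed

text \<open>
  Compare each term with the telescoping difference \<open>1/(k-1) - 1/k\<close>.
\<close>

lemma sum_inverse_squares_le:
  fixes y n :: nat assumes "y > 0"
  shows "(\<Sum>k\<in>{y<..n}. 1 / real k ^ 2) \<le> 1 / real y"
proof -
  have "(\<Sum>k\<in>{y<..n}. 1 / real k ^ 2) \<le> 1 / real y - 1 / real (max y n)"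
  proof (induction n)
    case (Suc n)
    show ?case
    proof (cases "y \<le> n")
      case True
      hence "{y<..Suc n} = insert (Suc n) {y<..n}" by auto
      moreover have "1 / real (Suc n) ^ 2 \<le> 1 / real n - 1 / real (Suc n)"
      proof -
        have n: "real n > 0" using True assms by simp
        have "1 / real (Suc n) ^ 2 \<le> 1 / (real n * real (Suc n))"
          using n by (intro divide_left_mono) (auto simp: power2_eq_square)
        also have "\<dots> = 1 / real n - 1 / real (Suc n)" using n by (simp add: field_simps)
        finally show ?thesis .
      qed
      ultimately show ?thesis using Suc True by (simp add: max_def)
    next
      case False
      hence "{y<..Suc n} = {}" "max y (Suc n) = y" by auto
      thus ?thesis by simp
    qed
  qed simp
  also have "\<dots> \<le> 1 / real y" by simp
  finally show ?thesis .
qed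

section \<open>Dirichlet series by partial summation\<close>

text \<open>
  The form is chosen so that bounded partial sums of \<open>c\<close> turn into an absolutely convergent
  right-hand side as soon as \<open>b\<close> has bounded variation.
\<close>

lemma summation_by_parts:
  fixes c :: "nat \<Rightarrow> 'a :: real_vector" and b :: "nat \<Rightarrow> real"
  shows "(\<Sum>k<n. b k *\<^sub>R c k) =
    b n *\<^sub>R (\<Sum>k<n. c k) - (\<Sum>k<n. (b (Suc k) - b k) *\<^sub>R (\<Sum>i<Suc k. c i))"
  by (induction n) (simp_all add: algebra_simps)

text \<open>
  Besides convergence this gives a bound in terms of the total variation of the weights. The
  three weights used below are \<open>n powr -s\<close>, the difference of two such powers, and the weights
  of Monsky's argument.
\<close>

lemma dirichlet_test_variation:
  fixes c :: "nat \<Rightarrow> 'a :: banach" and b :: "nat \<Rightarrow> real"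
  assumes S: "\<And>n. norm (\<Sum>k<n. c k) \<le> M"
    and b: "b \<longlonglongrightarrow> 0"
    and var: "summable (\<lambda>k. \<bar>b (Suc k) - b k\<bar>)"
  shows "summable (\<lambda>k. b k *\<^sub>R c k)"
    and "norm (\<Sum>k. b k *\<^sub>R c k) \<le> M * (\<Sum>k. \<bar>b (Suc k) - b k\<bar>)"
proof -
  have M: "M \<ge> 0" using S[of 0] by simp
  let ?g = "\<lambda>k. (b (Suc k) - b k) *\<^sub>R (\<Sum>i<Suc k. c i)"
  have le: "norm (?g k) \<le> M * \<bar>b (Suc k) - b k\<bar>" for k
  proof -
    have "\<bar>b (Suc k) - b k\<bar> * norm (\<Sum>i<Suc k. c i) \<le> \<bar>b (Suc k) - b k\<bar> * M"
      by (rule mult_left_mono[OF S]) simp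
    thus ?thesis by (simp add: mult.commute)
  qed
  have sumM: "summable (\<lambda>k. M * \<bar>b (Suc k) - b k\<bar>)" by (rule summable_mult[OF var])
  have sg: "summable ?g" by (rule summable_comparison_test'[OF sumM, of 0]) (rule le)
  have "(\<lambda>n. b n *\<^sub>R (\<Sum>k<n. c k)) \<longlonglongrightarrow> 0"
  proof (rule Lim_null_comparison)
    show "\<forall>\<^sub>F n in sequentially. norm (b n *\<^sub>R (\<Sum>k<n. c k)) \<le> \<bar>b n\<bar> * M"
      using S by (intro always_eventually allI) (simp add: mult_left_mono)
    show "(\<lambda>n. \<bar>b n\<bar> * M) \<longlonglongrightarrow> 0"
      using tendsto_mult[OF tendsto_rabs[OF b] tendsto_const[of M]] by simp
  qed
  hence "(\<lambda>n. b n *\<^sub>R (\<Sum>k<n. c k) - (\<Sum>k<n. ?g k)) \<longlonglongrightarrow> 0 - suminf ?g"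
    by (intro tendsto_diff summable_LIMSEQ sg)
  hence sums: "(\<lambda>k. b k *\<^sub>R c k) sums (- suminf ?g)"
    unfolding sums_def using summation_by_parts[of b c] by (simp only: diff_0)
  thus "summable (\<lambda>k. b k *\<^sub>R c k)" by (rule sums_summable)
  have "norm (\<Sum>k. b k *\<^sub>R c k) = norm (suminf ?g)"
    unfolding sums_unique[OF sums, symmetric] by (rule norm_minus_cancel)
  also have "\<dots> \<le> (\<Sum>k. M * \<bar>b (Suc k) - b k\<bar>)"
    by (rule norm_suminf_le[OF le sumM])
  also have "\<dots> = M * (\<Sum>k. \<bar>b (Suc k) - b k\<bar>)" by (rule suminf_mult[OF var])
  finally show "norm (\<Sum>k. b k *\<^sub>R c k) \<le> M * (\<Sum>k. \<bar>b (Suc k) - b k\<bar>)" .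
qed

text \<open>
  The weights jump from 0 to \<open>b 1\<close> and then decrease to 0, so the total variation is \<open>2 * b 1\<close>.
  Starting at 0 lets the weights be indexed by all natural numbers, with value 0 at 0.
\<close>

lemma variation_of_hump:
  fixes b :: "nat \<Rightarrow> real"
  assumes b0: "b 0 = 0" and dec: "\<And>n. n \<ge> 1 \<Longrightarrow> b (Suc n) \<le> b n" and lim: "b \<longlonglongrightarrow> 0"
  shows "(\<lambda>k. \<bar>b (Suc k) - b k\<bar>) sums (2 * b 1)"
proof -
  have "(\<lambda>n. b (Suc n)) \<longlonglongrightarrow> 0" using lim by (rule LIMSEQ_Suc)
  hence "(\<lambda>n. b (Suc n) - b (Suc (Suc n))) sums (b (Suc 0) - 0)" by (rule telescope_sums')
  moreover have "(\<lambda>n. b (Suc n) - b (Suc (Suc n))) = (\<lambda>n. \<bar>b (Suc (Suc n)) - b (Suc n)\<bar>)"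
  proof
    fix n
    have "b (Suc (Suc n)) \<le> b (Suc n)" by (rule dec) simp
    thus "b (Suc n) - b (Suc (Suc n)) = \<bar>b (Suc (Suc n)) - b (Suc n)\<bar>" by simp
  qed
  ultimately have *: "(\<lambda>n. \<bar>b (Suc (Suc n)) - b (Suc n)\<bar>) sums b 1" by simp
  have "b 1 \<ge> 0" by (rule sums_le[OF _ sums_zero *]) simp
  thus ?thesis using sums_Suc[OF *] b0 by simp
qed

text \<open>
  The term \<open>n = 0\<close> vanishes, since \<open>0 powr - s = 0\<close>. Only real \<open>s\<close> is considered, and
  \<open>scaleR\<close> lets the same definition serve real and complex coefficients.
\<close>

definition dirichlet_L :: "(nat \<Rightarrow> 'a) \<Rightarrow> real \<Rightarrow> 'a :: banach" where
  "dirichlet_L c s = (\<Sum>n. (real n powr - s) *\<^sub>R c n)"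

lemma powr_neg_tendsto_0: "s > 0 \<Longrightarrow> (\<lambda>n. real n powr - s) \<longlonglongrightarrow> 0"
  by (intro tendsto_neg_powr filterlim_real_sequentially) auto

lemma dirichlet_L_bounded:
  fixes c :: "nat \<Rightarrow> 'a :: banach"
  assumes S: "\<And>n. norm (\<Sum>k<n. c k) \<le> M" and s: "s > 0"
  shows "summable (\<lambda>n. (real n powr - s) *\<^sub>R c n)" and "norm (dirichlet_L c s) \<le> 2 * M"
proof -
  have "(\<lambda>k. \<bar>real (Suc k) powr - s - real k powr - s\<bar>) sums (2 * (real 1 powr - s))"
    using s by (intro variation_of_hump powr_neg_tendsto_0) (auto intro!: powr_mono2')
  hence var: "(\<lambda>k. \<bar>real (Suc k) powr - s - real k powr - s\<bar>) sums 2" by simp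
  show "summable (\<lambda>n. (real n powr - s) *\<^sub>R c n)"
    by (rule dirichlet_test_variation[OF S powr_neg_tendsto_0[OF s] sums_summable[OF var]])
  show "norm (dirichlet_L c s) \<le> 2 * M"
    using dirichlet_test_variation(2)[OF S powr_neg_tendsto_0[OF s] sums_summable[OF var]] sums_unique[OF var]
    by (simp add: dirichlet_L_def mult.commute)
qed

lemma powr_neg_plus_one:
  fixes x t :: real assumes "x > 0"
  shows "x powr - (1 + t) = x powr - t / x"
proof -
  have "x powr - (1 + t) = x powr (- t + - 1)" by (simp add: algebra_simps)
  also have "\<dots> = x powr - t * x powr - 1" by (rule powr_add)
  also have "\<dots> = x powr - t / x" using assms by (simp add: powr_neg_one)
  finally show ?thesis .
qed

lemma ln_Suc_diff_le:
  fixes x :: real assumes "x > 0"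
  shows "ln (x + 1) - ln x \<le> 1 / x"
proof -
  have "ln ((x + 1) / x) \<le> (x + 1) / x - 1" using assms by (intro ln_le_minus_one) simp
  also have "\<dots> = 1 / x" using assms by (simp add: field_simps)
  finally show ?thesis using assms by (simp add: ln_div)
qed

text \<open>
  Both the distance of \<open>n powr - t\<close> from 1 and its increment are proportional to \<open>t\<close>, by
  \<open>1 - exp (- y) \<le> y\<close>; the factor \<open>ln n\<close> that appears is absorbed into \<open>2 * sqrt n\<close>. What matters is
  a bound linear in \<open>t\<close> and summable in \<open>n\<close>.
\<close>

lemma powr_difference_variation:
  fixes n :: nat and t :: real
  assumes n: "n \<ge> 1" and t: "t \<ge> 0"
  defines "h \<equiv> \<lambda>k. real k powr - 1 - real k powr - (1 + t)"
  shows "\<bar>h (Suc n) - h n\<bar> \<le> t * (3 * real n powr - (3 / 2))"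
proof -
  define x y where "x = real n" and "y = real (Suc n)"
  have x: "x \<ge> 1" and y: "y = x + 1" using n by (simp_all add: x_def y_def)
  define u v where "u = x powr - t" and "v = y powr - t"
  have hx: "h n = (1 - u) / x" and hy: "h (Suc n) = (1 - v) / y"
    using x y unfolding h_def x_def[symmetric] y_def[symmetric] u_def v_def
    by (simp_all only: powr_neg_plus_one) (simp_all add: powr_neg_one diff_divide_distrib)
  have ue: "u = exp (- (t * ln x))" and ve: "v = exp (- (t * ln y))"
    using x y by (simp_all add: u_def v_def powr_def)
  have "t * ln x \<ge> 0" using x t by simp
  hence u1: "1 - u \<le> t * ln x" "1 - u \<ge> 0" "u \<ge> 0"
    using exp_ge_add_one_self[of "- (t * ln x)"] unfolding ue by (linarith, simp_all)
  have "v = u * exp (- (t * (ln y - ln x)))"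
    unfolding ue ve exp_add[symmetric] by (simp add: algebra_simps)
  hence uv_eq: "u - v = u * (1 - exp (- (t * (ln y - ln x))))" by (simp add: algebra_simps)
  have lny: "ln y - ln x \<le> 1 / x" "ln y - ln x \<ge> 0"
    using ln_Suc_diff_le[of x] x y by simp_all
  have e: "1 - exp (- (t * (ln y - ln x))) \<le> t * (ln y - ln x)"
    using exp_ge_add_one_self[of "- (t * (ln y - ln x))"] by linarith
  have e0: "1 - exp (- (t * (ln y - ln x))) \<ge> 0" using lny t by simp
  have uv: "0 \<le> u - v" "u - v \<le> t * (1 / x)"
  proof -
    show "0 \<le> u - v" unfolding uv_eq using e0 u1 by simp
    have "u - v \<le> 1 * (t * (ln y - ln x))"
      unfolding uv_eq using u1 e e0 by (intro mult_mono) auto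
    also have "\<dots> \<le> t * (1 / x)" unfolding mult_1_left by (rule mult_left_mono[OF lny(1) t])
    finally show "u - v \<le> t * (1 / x)" .
  qed
  have eq: "h n - h (Suc n) = (1 - u) / (x * y) - (u - v) / y"
    unfolding hx hy using x y by (simp add: divide_simps) (simp add: algebra_simps)
  have sq: "x powr - (3 / 2) = sqrt x / (x * x)"
  proof -
    have "x powr - (3 / 2) = x powr (1 / 2 - 2)" by simp
    also have "\<dots> = x powr (1 / 2) / x powr 2" by (rule powr_diff)
    also have "\<dots> = sqrt x / (x * x)" using x by (simp add: powr_half_sqrt power2_eq_square)
    finally show ?thesis .
  qed
  have lnx: "ln x \<le> 2 * sqrt x"
  proof -
    have "ln (sqrt x) \<le> sqrt x" using x by (intro order_trans[OF ln_le_minus_one]) auto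
    thus ?thesis using x by (simp add: ln_sqrt)
  qed
  have s1: "1 \<le> sqrt x" using x by simp
  have a: "(1 - u) / (x * y) \<le> t * (2 * sqrt x / (x * x))"
  proof -
    have "(1 - u) / (x * y) \<le> (t * (2 * sqrt x)) / (x * x)"
      using u1 x y lnx t by (intro frac_le) (auto intro: order_trans mult_left_mono)
    thus ?thesis by simp
  qed
  have b: "(u - v) / y \<le> t * (1 / (x * x))"
  proof -
    have "(u - v) / y \<le> (t * (1 / x)) / x" using uv x y t by (intro frac_le) auto
    thus ?thesis by simp
  qed
  have c: "t * (1 / (x * x)) \<le> t * (3 * (sqrt x / (x * x)))" "t * (2 * sqrt x / (x * x)) \<le> t * (3 * (sqrt x / (x * x)))"
  proof -
    have "1 \<le> 3 * sqrt x" "2 * sqrt x \<le> 3 * sqrt x" using s1 by linarith+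
    hence "1 / (x * x) \<le> 3 * sqrt x / (x * x)" "2 * sqrt x / (x * x) \<le> 3 * sqrt x / (x * x)"
      by (auto intro: divide_right_mono)
    hence c': "1 / (x * x) \<le> 3 * (sqrt x / (x * x))" "2 * sqrt x / (x * x) \<le> 3 * (sqrt x / (x * x))"
      by (simp_all only: times_divide_eq_right)
    show "t * (1 / (x * x)) \<le> t * (3 * (sqrt x / (x * x)))"
      by (rule mult_left_mono[OF c'(1) t])
    show "t * (2 * sqrt x / (x * x)) \<le> t * (3 * (sqrt x / (x * x)))"
      by (rule mult_left_mono[OF c'(2) t])
  qed
  have "(1 - u) / (x * y) \<ge> 0" "(u - v) / y \<ge> 0" using u1 uv x y by simp_all
  hence "\<bar>h n - h (Suc n)\<bar> \<le> t * (3 * (sqrt x / (x * x)))" unfolding eq using a b c by linarith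
  thus ?thesis unfolding x_def[symmetric] sq by (simp only: abs_minus_commute)
qed

text \<open>
  A zero at 1 therefore forces \<open>L\<close> to be \<open>O(t)\<close> at \<open>1 + t\<close>, and a non-zero value at 1 stays
  away from 0 nearby; no derivative of \<open>L\<close> is needed.
\<close>

lemma dirichlet_L_lipschitz:
  fixes c :: "nat \<Rightarrow> 'a :: banach"
  assumes S: "\<And>n. norm (\<Sum>k<n. c k) \<le> M" and t: "t \<ge> 0"
  shows "norm (dirichlet_L c 1 - dirichlet_L c (1 + t)) \<le> M * (\<Sum>n. 3 * real n powr - (3 / 2)) * t"
proof -
  define h where "h = (\<lambda>k. real k powr - 1 - real k powr - (1 + t))"
  have lim: "h \<longlonglongrightarrow> 0"
    unfolding h_def using tendsto_diff[OF powr_neg_tendsto_0[of 1] powr_neg_tendsto_0[of "1 + t"]] t by simp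
  have M: "M \<ge> 0" using S[of 0] by simp
  have sm: "summable (\<lambda>n. 3 * real n powr - (3 / 2))"
    by (intro summable_mult) (simp add: summable_real_powr_iff)
  have sm': "summable (\<lambda>n. t * (3 * real n powr - (3 / 2)))" by (rule summable_mult[OF sm])
  have le: "norm \<bar>h (Suc n) - h n\<bar> \<le> t * (3 * real n powr - (3 / 2))" for n
  proof (cases "n = 0")
    case True
    thus ?thesis by (simp add: h_def)
  next
    case False
    thus ?thesis using powr_difference_variation[of n t] t by (simp add: h_def)
  qed
  have var: "summable (\<lambda>n. \<bar>h (Suc n) - h n\<bar>)"
    by (rule summable_comparison_test'[OF sm', of 0]) (rule le)
  have s1: "summable (\<lambda>n. (real n powr - 1) *\<^sub>R c n)" "summable (\<lambda>n. (real n powr - (1 + t)) *\<^sub>R c n)"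
    by (rule dirichlet_L_bounded[OF S], use t in simp)+
  have "dirichlet_L c 1 - dirichlet_L c (1 + t) = (\<Sum>n. h n *\<^sub>R c n)"
    unfolding dirichlet_L_def h_def using suminf_diff[OF s1] by (simp add: scaleR_left_diff_distrib)
  also have "norm \<dots> \<le> M * (\<Sum>n. \<bar>h (Suc n) - h n\<bar>)"
    by (rule dirichlet_test_variation[OF S lim var])
  also have "\<dots> \<le> M * (\<Sum>n. t * (3 * real n powr - (3 / 2)))"
    using le by (intro mult_left_mono suminf_le var sm' M) auto
  also have "\<dots> = M * (\<Sum>n. 3 * real n powr - (3 / 2)) * t"
    by (simp add: suminf_mult[OF sm] mult.commute mult.left_commute)
  finally show ?thesis .
qed

text \<open>
  The integral comparison for \<open>x powr -(1+t)\<close>, with the integral over \<open>[n, n+1]\<close> written out so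
  that it telescopes.
\<close>

lemma zeta_term_bounds:
  fixes t :: real and n :: nat
  assumes t: "t > 0" and n: "n \<ge> 1"
  shows "real (Suc n) powr - (1 + t) \<le> (real n powr - t - real (Suc n) powr - t) / t"
    and "(real n powr - t - real (Suc n) powr - t) / t \<le> real n powr - (1 + t)"
proof -
  define x y where "x = real n" and "y = real (Suc n)"
  have x: "x \<ge> 1" and y: "y = x + 1" using n by (simp_all add: x_def y_def)
  define d where "d = ln y - ln x"
  have d: "1 / y \<le> d" "d \<le> 1 / x"
  proof -
    show "d \<le> 1 / x" using ln_Suc_diff_le[of x] x y by (simp add: d_def)
    have "ln (x / y) \<le> x / y - 1" using x y by (intro ln_le_minus_one) auto
    also have "\<dots> = - (1 / y)" using x y by (simp add: field_simps)
    also have "ln (x / y) = - d" using x y by (simp add: d_def ln_div)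
    finally show "1 / y \<le> d" by simp
  qed
  have px: "x powr - t > 0" and py: "y powr - t > 0" using x y by simp_all
  have ex: "x powr - (1 + t) = x powr - t * (1 / x)" "y powr - (1 + t) = y powr - t * (1 / y)"
    using x y powr_neg_plus_one[of x t] powr_neg_plus_one[of y t] by (simp_all only: times_divide_eq_right mult_1_right)
  have "x powr - t = y powr - t * exp (t * d)" "y powr - t = x powr - t * exp (- (t * d))"
    using x y by (simp_all add: powr_def d_def exp_add[symmetric] algebra_simps)
  have "y powr - t * (t * (1 / y)) \<le> y powr - t * (exp (t * d) - 1)"
  proof (rule mult_left_mono)
    have "t * (1 / y) \<le> t * d" using d t by (intro mult_left_mono) auto
    also have "\<dots> \<le> exp (t * d) - 1" using exp_ge_add_one_self[of "t * d"] by linarith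
    finally show "t * (1 / y) \<le> exp (t * d) - 1" .
  qed (use py in simp)
  also have "\<dots> = x powr - t - y powr - t"
    using \<open>x powr - t = _\<close> by (simp add: algebra_simps)
  finally have "t * (y powr - (1 + t)) \<le> x powr - t - y powr - t" unfolding ex by (simp only: mult.left_commute)
  thus "real (Suc n) powr - (1 + t) \<le> (real n powr - t - real (Suc n) powr - t) / t"
    using t unfolding x_def[symmetric] y_def[symmetric] by (simp add: pos_le_divide_eq mult.commute)
  have "x powr - t - y powr - t = x powr - t * (1 - exp (- (t * d)))"
    using \<open>y powr - t = _\<close> by (simp add: algebra_simps)
  also have "\<dots> \<le> x powr - t * (t * (1 / x))"
  proof (rule mult_left_mono)
    have "1 - exp (- (t * d)) \<le> t * d" using exp_ge_add_one_self[of "- (t * d)"] by linarith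
    also have "\<dots> \<le> t * (1 / x)" using d t by (intro mult_left_mono) auto
    finally show "1 - exp (- (t * d)) \<le> t * (1 / x)" .
  qed (use px in simp)
  finally have "x powr - t - y powr - t \<le> t * (x powr - (1 + t))" unfolding ex by (simp only: mult.left_commute)
  thus "(real n powr - t - real (Suc n) powr - t) / t \<le> real n powr - (1 + t)"
    using t unfolding x_def[symmetric] y_def[symmetric] by (simp add: pos_divide_le_eq mult.commute)
qed

lemma zeta_bounds:
  fixes t :: real
  assumes t: "t > 0"
  shows "1 / t \<le> (\<Sum>n. real n powr - (1 + t))" and "(\<Sum>n. real n powr - (1 + t)) \<le> 1 + 1 / t"
proof -
  let ?z = "\<lambda>n. real n powr - (1 + t)"
  have sm: "summable ?z" using t by (simp add: summable_real_powr_iff)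
  have sm1: "summable (\<lambda>n. ?z (Suc n))" by (rule summable_Suc_iff[THEN iffD2, OF sm])
  have sm2: "summable (\<lambda>n. ?z (Suc (Suc n)))" by (rule summable_Suc_iff[THEN iffD2, OF sm1])
  have "(\<lambda>n. real (Suc n) powr - t) \<longlonglongrightarrow> 0"
    using powr_neg_tendsto_0[OF t] by (rule LIMSEQ_Suc)
  hence "(\<lambda>n. real (Suc n) powr - t - real (Suc (Suc n)) powr - t) sums (real (Suc 0) powr - t - 0)"
    by (rule telescope_sums')
  hence "(\<lambda>n. (real (Suc n) powr - t - real (Suc (Suc n)) powr - t) / t) sums (1 / t)"
    by (intro sums_divide) simp
  note T = sums_summable[OF this] sums_unique[OF this]
  have z0: "suminf ?z = (\<Sum>n. ?z (Suc n))" using suminf_split_head[OF sm] by simp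
  have z1: "(\<Sum>n. ?z (Suc n)) = 1 + (\<Sum>n. ?z (Suc (Suc n)))"
    using suminf_split_head[OF sm1] by simp
  have "1 / t \<le> (\<Sum>n. ?z (Suc n))"
    unfolding T(2) by (rule suminf_le[OF zeta_term_bounds(2)[OF t] T(1) sm1]) simp
  thus "1 / t \<le> suminf ?z" unfolding z0 .
  have "(\<Sum>n. ?z (Suc (Suc n))) \<le> 1 / t"
    unfolding T(2) by (rule suminf_le[OF zeta_term_bounds(1)[OF t] sm2 T(1)]) simp
  thus "suminf ?z \<le> 1 + 1 / t" unfolding z0 z1 by simp
qed

section \<open>The Euler product in absolute value\<close>

lemma infsum_multiples:
  fixes f :: "nat \<Rightarrow> complex"
  assumes mult: "\<And>m n. f (m * n) = f m * f n" and q: "q > 0"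
  shows "infsum f ((*) q ` A) = f q * infsum f A"
proof -
  have "infsum f ((*) q ` A) = infsum (f \<circ> (*) q) A"
    using q by (intro infsum_reindex) (simp add: inj_on_def)
  also have "\<dots> = (\<Sum>\<^sub>\<infinity>n\<in>A. f q * f n)" by (intro infsum_cong) (simp add: mult)
  also have "\<dots> = f q * infsum f A" by (rule infsum_cmult_right')
  finally show ?thesis .
qed

text \<open>
  Euler's original sieve: removing the multiples of one more prime \<open>p\<close> from the sum multiplies
  it by \<open>1 - f p\<close>, because those multiples are \<open>p\<close> times the integers that survived so far. This
  avoids expanding a product of geometric series.
\<close>

lemma euler_sieve:
  fixes f :: "nat \<Rightarrow> complex"
  assumes mult: "\<And>m n. f (m * n) = f m * f n" and sm: "f summable_on UNIV"
    and P: "finite P" "\<And>q. q \<in> P \<Longrightarrow> prime q"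
  shows "infsum f {n. n > 0 \<and> (\<forall>q\<in>P. \<not> q dvd n)} = (\<Prod>q\<in>P. 1 - f q) * infsum f {0<..}"
  using P
proof (induction rule: finite_induct)
  case empty
  have "{n::nat. n > 0 \<and> (\<forall>q\<in>{}. \<not> q dvd n)} = {0<..}" by auto
  thus ?case by simp
next
  case (insert p P)
  let ?A = "{n. n > 0 \<and> (\<forall>q\<in>P. \<not> q dvd n)}"
  let ?B = "{n. n > 0 \<and> (\<forall>q\<in>insert p P. \<not> q dvd n)}"
  have p: "prime p" using insert.prems by simp
  have p0: "p > 0" using p by (rule prime_gt_0_nat)
  have ndvd: "q dvd p * m \<longleftrightarrow> q dvd m" if "q \<in> P" for q m
  proof -
    have "prime q" using that insert.prems by simp
    have "q \<noteq> p" using that insert.hyps(2) by blast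
    hence "\<not> q dvd p" using primes_dvd_imp_eq[OF \<open>prime q\<close> p] by blast
    thus ?thesis using prime_dvd_mult_iff[OF \<open>prime q\<close>] by blast
  qed
  have split: "?A = ?B \<union> (*) p ` ?A"
  proof (intro equalityI subsetI)
    fix n assume n: "n \<in> ?A"
    show "n \<in> ?B \<union> (*) p ` ?A"
    proof (cases "p dvd n")
      case True
      then obtain m where m: "n = p * m" by (rule dvdE)
      have "m > 0" using n m by (cases m) simp_all
      moreover have "\<not> q dvd m" if "q \<in> P" for q
        using n m ndvd[OF that, of m] that by simp
      ultimately have "m \<in> ?A" by simp
      thus ?thesis unfolding m by (intro UnI2 imageI)
    next
      case False
      thus ?thesis using n by simp
    qed
  next
    fix n assume "n \<in> ?B \<union> (*) p ` ?A"
    thus "n \<in> ?A"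
    proof (rule UnE)
      assume "n \<in> ?B"
      thus ?thesis by simp
    next
      assume "n \<in> (*) p ` ?A"
      then obtain m where m: "n = p * m" "m \<in> ?A" by (rule imageE)
      have "n > 0" using m p0 by simp
      moreover have "\<not> q dvd n" if "q \<in> P" for q
        unfolding m(1) ndvd[OF that] using m(2) that by simp
      ultimately show ?thesis by simp
    qed
  qed
  have disj: "?B \<inter> (*) p ` ?A = {}"
  proof (rule equals0I)
    fix n assume n: "n \<in> ?B \<inter> (*) p ` ?A"
    from n have "n \<in> (*) p ` ?A" by (rule IntD2)
    then obtain m where "n = p * m" by (rule imageE)
    hence "p dvd n" by simp
    moreover have "\<not> p dvd n" using n by simp
    ultimately show False by simp
  qed
  have smA: "f summable_on A" for A by (rule summable_on_subset[OF sm]) simp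
  have "infsum f ?A = infsum f ?B + infsum f ((*) p ` ?A)"
    using infsum_Un_disjoint[OF smA smA disj] by (simp only: split[symmetric])
  also have "infsum f ((*) p ` ?A) = f p * infsum f ?A" by (rule infsum_multiples[OF mult p0])
  finally have "infsum f ?B = infsum f ?A - f p * infsum f ?A"
    by (rule eq_diff_eq[THEN iffD2, OF sym])
  hence "infsum f ?B = (1 - f p) * infsum f ?A" by (simp only: left_diff_distrib mult_1_left)
  also have "infsum f ?A = (\<Prod>q\<in>P. 1 - f q) * infsum f {0<..}"
    by (rule insert.IH) (simp add: insert.prems)
  finally show ?case unfolding prod.insert[OF insert.hyps(1,2)] by (simp only: mult.assoc)
qed

text \<open>
  After sieving by the primes below \<open>N\<close>, only 1 and integers \<open>\<ge> N\<close> remain, so the sieved sum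
  differs from \<open>f 1 = 1\<close> by at most a tail of the series.
\<close>

lemma euler_product:
  fixes f :: "nat \<Rightarrow> complex"
  assumes mult: "\<And>m n. f (m * n) = f m * f n" and f1: "f 1 = 1" and f0: "f 0 = 0"
    and sm: "summable (\<lambda>n. norm (f n))"
  shows "(\<lambda>N. (\<Prod>q | prime q \<and> q < N. 1 - f q) * suminf f) \<longlonglongrightarrow> 1"
proof -
  have smU: "f summable_on UNIV" using sm by (rule norm_summable_imp_summable_on)
  have hs: "(f has_sum suminf f) UNIV"
    by (rule norm_summable_imp_has_sum[OF sm summable_sums[OF summable_norm_cancel[OF sm]]])
  have smA: "f summable_on A" for A by (rule summable_on_subset[OF smU]) simp
  have L: "infsum f {0<..} = suminf f"
  proof -
    have "infsum f {0<..} = infsum f UNIV"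
      by (intro infsum_cong_neutral) (auto simp: f0)
    thus ?thesis using infsumI[OF hs] by simp
  qed
  let ?R = "\<lambda>N. \<Sum>n. norm (f (n + N))"
  have R: "?R \<longlonglongrightarrow> 0" by (rule suminf_exist_split2[OF sm])
  have bound: "norm ((\<Prod>q | prime q \<and> q < N. 1 - f q) * suminf f - 1) \<le> ?R N" if N: "N \<ge> 2" for N
  proof -
    let ?A = "{n. n > 0 \<and> (\<forall>q\<in>{q. prime q \<and> q < N}. \<not> q dvd n)}"
    have eq: "infsum f ?A = (\<Prod>q | prime q \<and> q < N. 1 - f q) * suminf f"
      unfolding L[symmetric] by (rule euler_sieve[OF mult smU]) auto
    have sub: "?A - {1} \<subseteq> {N..}"
    proof
      fix n assume n: "n \<in> ?A - {1}"
      then obtain q where q: "prime q" "q dvd n" using prime_factor_nat[of n] by auto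
      hence "q \<le> n" using n by (auto dest: dvd_imp_le)
      moreover have "\<not> q < N" using n q by blast
      ultimately show "n \<in> {N..}" by simp
    qed
    have "1 \<in> ?A" using prime_gt_1_nat by (auto dest: prime_gt_1_nat)
    hence "?A = {1} \<union> (?A - {1})" by blast
    hence "infsum f ?A = infsum f {1} + infsum f (?A - {1})"
      using infsum_Un_disjoint[OF smA smA, of "{1}" "?A - {1}"] by simp
    hence "infsum f ?A - 1 = infsum f (?A - {1})" using f1 by simp
    moreover have "norm (infsum f (?A - {1})) \<le> ?R N"
    proof -
      have nsU: "(\<lambda>n. norm (f n)) summable_on UNIV"
        by (rule summable_nonneg_imp_summable_on[OF sm]) simp
      have ns: "(\<lambda>n. norm (f n)) summable_on B" for B by (rule summable_on_subset[OF nsU]) simp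
      have "norm (infsum f (?A - {1})) \<le> infsum (\<lambda>n. norm (f n)) (?A - {1})"
        by (rule norm_infsum_bound[OF ns])
      also have "\<dots> \<le> infsum (\<lambda>n. norm (f n)) {N..}"
        by (rule infsum_mono2[OF ns ns sub]) simp
      also have "{N..} = (\<lambda>n. n + N) ` UNIV"
        by (auto simp: image_iff) (metis add.commute le_iff_add)
      also have "infsum (\<lambda>n. norm (f n)) \<dots> = infsum ((\<lambda>n. norm (f n)) \<circ> (\<lambda>n. n + N)) UNIV"
        by (rule infsum_reindex) simp
      also have "\<dots> = ?R N"
      proof (rule infsumI, rule sums_nonneg_imp_has_sum)
        show "((\<lambda>n. norm (f n)) \<circ> (\<lambda>n. n + N)) sums ?R N"
          unfolding o_def by (rule summable_sums[OF summable_ignore_initial_segment[OF sm]])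
      qed simp
      finally show ?thesis .
    qed
    ultimately show ?thesis unfolding eq by simp
  qed
  have "(\<lambda>N. (\<Prod>q | prime q \<and> q < N. 1 - f q) * suminf f - 1) \<longlonglongrightarrow> 0"
    by (rule Lim_null_comparison[OF _ R]) (use bound in \<open>auto intro: eventually_mono[OF eventually_ge_at_top[of 2]]\<close>)
  thus ?thesis by (simp add: LIM_zero_iff)
qed

lemma norm_one_minus_le_exp:
  fixes z :: complex
  shows "norm (1 - z) \<le> exp (- Re z + (norm z)\<^sup>2 / 2)"
proof (rule power2_le_imp_le)
  have "(norm (1 - z))\<^sup>2 = 1 + (- 2 * Re z + (norm z)\<^sup>2)"
    unfolding cmod_power2 by (simp add: power2_eq_square algebra_simps)
  also have "\<dots> \<le> exp (- 2 * Re z + (norm z)\<^sup>2)" by (rule exp_ge_add_one_self)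
  also have "\<dots> = (exp (- Re z + (norm z)\<^sup>2 / 2))\<^sup>2"
    by (simp add: power2_eq_square exp_add[symmetric])
  finally show "(norm (1 - z))\<^sup>2 \<le> (exp (- Re z + (norm z)\<^sup>2 / 2))\<^sup>2" .
qed simp

text \<open>
  Apply the upper bound to \<open>w = - z / (1 - z)\<close>, for which \<open>1 - w = 1 / (1 - z)\<close>.
\<close>

lemma exp_le_norm_one_minus:
  fixes z :: complex
  assumes z: "norm z \<le> 1 / 2"
  shows "exp (- Re z - 4 * (norm z)\<^sup>2) \<le> norm (1 - z)"
proof -
  have n1: "norm (1 - z) \<ge> 1 / 2" using norm_triangle_ineq2[of 1 z] z by simp
  hence nz: "1 - z \<noteq> 0" by auto
  define w where "w = - z / (1 - z)"
  have w1: "1 - w = inverse (1 - z)" using nz by (simp add: w_def field_simps)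
  have "norm w = norm z / norm (1 - z)" by (simp add: w_def norm_divide)
  also have "\<dots> \<le> norm z / (1 / 2)" using n1 by (intro divide_left_mono) auto
  finally have w: "norm w \<le> 2 * norm z" by simp
  have weq: "- w = z + z\<^sup>2 / (1 - z)" using nz by (simp add: w_def field_simps power2_eq_square)
  have "Re (z\<^sup>2 / (1 - z)) \<le> norm (z\<^sup>2 / (1 - z))" by (rule complex_Re_le_cmod)
  also have "\<dots> = (norm z)\<^sup>2 / norm (1 - z)" by (simp add: norm_divide norm_power)
  also have "\<dots> \<le> (norm z)\<^sup>2 / (1 / 2)" using n1 by (intro divide_left_mono) auto
  finally have "Re (z\<^sup>2 / (1 - z)) \<le> 2 * (norm z)\<^sup>2" by simp
  moreover have "- Re w = Re z + Re (z\<^sup>2 / (1 - z))" using arg_cong[OF weq, of Re] by simp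
  ultimately have re: "- Re w \<le> Re z + 2 * (norm z)\<^sup>2" by linarith
  have "(norm w)\<^sup>2 \<le> (2 * norm z)\<^sup>2" using w by (intro power_mono) auto
  hence "(norm w)\<^sup>2 / 2 \<le> 2 * (norm z)\<^sup>2" by (simp add: power_mult_distrib)
  with re have "- Re w + (norm w)\<^sup>2 / 2 \<le> Re z + 4 * (norm z)\<^sup>2" by linarith
  hence "norm (inverse (1 - z)) \<le> exp (Re z + 4 * (norm z)\<^sup>2)"
    using norm_one_minus_le_exp[of w] unfolding w1 by (meson exp_le_cancel_iff order_trans)
  hence "inverse (exp (Re z + 4 * (norm z)\<^sup>2)) \<le> inverse (inverse (norm (1 - z)))"
    using nz by (intro le_imp_inverse_le) (auto simp: norm_inverse)
  thus ?thesis by (simp add: exp_minus[symmetric])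
qed

text \<open>
  Taking absolute values removes any need for complex logarithms. The error per prime is at most
  \<open>4 / q\<^sup>2\<close>, and these errors add up to at most 4, whatever \<open>f\<close> is; this uniformity is what is
  used when \<open>s\<close> tends to 1.
\<close>

lemma euler_product_bounds:
  fixes f :: "nat \<Rightarrow> complex"
  assumes mult: "\<And>m n. f (m * n) = f m * f n" and f1: "f 1 = 1" and f0: "f 0 = 0"
    and sm: "summable (\<lambda>n. norm (f n))" and small: "\<And>n. n > 0 \<Longrightarrow> norm (f n) \<le> 1 / real n"
  defines "E \<equiv> (\<Sum>q. if prime q then Re (f q) else 0)"
  shows "exp (E - 4) \<le> norm (suminf f)" and "norm (suminf f) \<le> exp (E + 4)"
proof -
  define EN where "EN = (\<lambda>N. \<Sum>q | prime q \<and> q < N. Re (f q))"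
  define PN where "PN = (\<lambda>N. \<Prod>q | prime q \<and> q < N. norm (1 - f q))"
  have "summable (\<lambda>q. if prime q then Re (f q) else 0)"
    by (rule summable_comparison_test'[OF sm, of 0]) (auto simp: abs_Re_le_cmod)
  hence "(\<lambda>N. \<Sum>q<N. if prime q then Re (f q) else 0) \<longlonglongrightarrow> E"
    unfolding E_def by (rule summable_LIMSEQ)
  moreover have "(\<Sum>q<N. if prime q then Re (f q) else 0) = EN N" for N
  proof -
    have eq: "{q. prime q \<and> q < N} = {q \<in> {..<N}. prime q}" by auto
    show ?thesis unfolding EN_def eq by (rule sum.inter_filter[symmetric]) simp
  qed
  ultimately have ENlim: "EN \<longlonglongrightarrow> E" by simp
  have fin: "finite {q::nat. prime q \<and> q < N}" for N by simp
  have half: "norm (f q) \<le> 1 / 2" if "prime q" for q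
  proof -
    have q: "real q \<ge> 2" using prime_ge_2_nat[OF that] by simp
    hence "norm (f q) \<le> 1 / real q" by (intro small) simp
    also have "\<dots> \<le> 1 / 2" using q by (intro divide_left_mono) auto
    finally show ?thesis .
  qed
  have sqs: "(\<Sum>q | prime q \<and> q < N. (norm (f q))\<^sup>2) \<le> 1" for N
  proof -
    have "(\<Sum>q | prime q \<and> q < N. (norm (f q))\<^sup>2) \<le> (\<Sum>q | prime q \<and> q < N. 1 / real q ^ 2)"
    proof (rule sum_mono)
      fix q assume "q \<in> {q. prime q \<and> q < N}"
      hence "q > 0" by (simp add: prime_gt_0_nat)
      hence "(norm (f q))\<^sup>2 \<le> (1 / real q)\<^sup>2" by (intro power_mono small) auto
      thus "(norm (f q))\<^sup>2 \<le> 1 / real q ^ 2" by (simp add: power_divide)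
    qed
    also have "\<dots> \<le> (\<Sum>k\<in>{1<..N}. 1 / real k ^ 2)"
      by (rule sum_mono2) (auto dest: prime_gt_1_nat)
    also have "\<dots> \<le> 1" using sum_inverse_squares_le[of 1 N] by simp
    finally show ?thesis .
  qed
  have lim: "(\<lambda>N. PN N * norm (suminf f)) \<longlonglongrightarrow> 1"
    using tendsto_norm[OF euler_product[OF mult f1 f0 sm]] by (simp add: PN_def norm_mult prod_norm)
  have up: "PN N \<le> exp (- EN N + 4)" for N
  proof -
    have "PN N \<le> (\<Prod>q | prime q \<and> q < N. exp (- Re (f q) + (norm (f q))\<^sup>2 / 2))"
      unfolding PN_def by (intro prod_mono conjI norm_one_minus_le_exp norm_ge_zero)
    also have "\<dots> = exp (\<Sum>q | prime q \<and> q < N. - Re (f q) + (norm (f q))\<^sup>2 / 2)"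
      by (rule exp_sum[OF fin, symmetric])
    also have "(\<Sum>q | prime q \<and> q < N. - Re (f q) + (norm (f q))\<^sup>2 / 2) =
        - EN N + (\<Sum>q | prime q \<and> q < N. (norm (f q))\<^sup>2) / 2"
      unfolding EN_def sum.distrib sum_negf sum_divide_distrib ..
    also have "exp \<dots> \<le> exp (- EN N + 4)" using sqs[of N] by (intro exp_le_cancel_iff[THEN iffD2]) linarith
    finally show ?thesis .
  qed
  have lo: "exp (- EN N - 4) \<le> PN N" for N
  proof -
    have "exp (- EN N - 4) \<le> exp (- EN N - 4 * (\<Sum>q | prime q \<and> q < N. (norm (f q))\<^sup>2))"
      using sqs[of N] by (intro exp_le_cancel_iff[THEN iffD2]) linarith
    also have "- EN N - 4 * (\<Sum>q | prime q \<and> q < N. (norm (f q))\<^sup>2) =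
      (\<Sum>q | prime q \<and> q < N. - Re (f q) - 4 * (norm (f q))\<^sup>2)"
      unfolding EN_def sum_subtractf sum_negf sum_distrib_left ..
    also have "exp \<dots> = (\<Prod>q | prime q \<and> q < N. exp (- Re (f q) - 4 * (norm (f q))\<^sup>2))"
      by (rule exp_sum[OF fin])
    also have "\<dots> \<le> PN N"
      unfolding PN_def using half by (intro prod_mono conjI exp_le_norm_one_minus) auto
    finally show ?thesis .
  qed
  have "(\<lambda>N. exp (- EN N + 4) * norm (suminf f)) \<longlonglongrightarrow> exp (- E + 4) * norm (suminf f)"
    by (intro tendsto_intros ENlim)
  hence "1 \<le> exp (- E + 4) * norm (suminf f)"
    by (rule LIMSEQ_le[OF lim]) (use up in \<open>auto intro!: mult_right_mono\<close>)
  hence "exp (E - 4) * 1 \<le> exp (E - 4) * (exp (- E + 4) * norm (suminf f))"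
    by (rule mult_left_mono) simp
  also have "\<dots> = norm (suminf f)" by (simp add: mult.assoc[symmetric] exp_add[symmetric])
  finally show "exp (E - 4) \<le> norm (suminf f)" by simp
  have "(\<lambda>N. exp (- EN N - 4) * norm (suminf f)) \<longlonglongrightarrow> exp (- E - 4) * norm (suminf f)"
    by (intro tendsto_intros ENlim)
  hence "exp (- E - 4) * norm (suminf f) \<le> 1"
    by (rule LIMSEQ_le[OF _ lim]) (use lo in \<open>auto intro!: mult_right_mono\<close>)
  hence "exp (E + 4) * (exp (- E - 4) * norm (suminf f)) \<le> exp (E + 4) * 1"
    by (rule mult_left_mono) simp
  moreover have "exp (E + 4) * (exp (- E - 4) * norm (suminf f)) = norm (suminf f)"
    by (simp add: mult.assoc[symmetric] exp_add[symmetric])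
  ultimately show "norm (suminf f) \<le> exp (E + 4)" by simp
qed

section \<open>Non-vanishing at 1 for real characters\<close>

text \<open>
  The exponent \<open>k\<close> is arbitrary, so one step removes all factors \<open>q\<close> of the number.
\<close>

lemma coprime_prime_power_induct [consumes 1, case_names one prime_power]:
  fixes n :: nat
  assumes "n > 0" and one: "P 1"
    and step: "\<And>q k m. prime q \<Longrightarrow> \<not> q dvd m \<Longrightarrow> m > 0 \<Longrightarrow> P m \<Longrightarrow> P (q ^ k * m)"
  shows "P n"
  using assms(1)
proof (induction n rule: less_induct)
  case (less n)
  show ?case
  proof (cases "n = 1")
    case True
    thus ?thesis using one by simp
  next
    case False
    then obtain q where q: "prime q" "q dvd n" using prime_factor_nat by blast
    have "\<not> is_unit q" using q(1) by auto
    with less.prems obtain m where m: "n = q ^ multiplicity q n * m" "\<not> q dvd m"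
      using multiplicity_decompose'[of n q] by auto
    have m0: "m > 0" using m less.prems by (cases m) auto
    have "multiplicity q n > 0" using q less.prems by (simp add: prime_multiplicity_gt_zero_iff)
    hence "q ^ multiplicity q n > 1" by (rule one_less_power[OF prime_gt_1_nat[OF q(1)]])
    hence "1 * m < q ^ multiplicity q n * m" using m0 by (rule mult_strict_right_mono)
    hence "m < n" using m(1) by (simp only: mult_1_left)
    hence "P m" using less.IH m0 by blast
    hence "P (q ^ multiplicity q n * m)" by (rule step[OF q(1) m(2) m0])
    thus ?thesis using m(1) by (simp only:)
  qed
qed

lemma completely_mult_power:
  fixes c :: "nat \<Rightarrow> 'a :: monoid_mult"
  assumes mult: "\<And>m n. c (m * n) = c m * c n" and c1: "c 1 = 1"
  shows "c (q ^ i) = c q ^ i"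
proof (induction i)
  case 0
  show ?case using c1 by simp
next
  case (Suc i)
  thus ?case by (simp add: mult)
qed

lemma sum_divisors_prime_power_mult:
  fixes c :: "nat \<Rightarrow> real"
  assumes mult: "\<And>m n. c (m * n) = c m * c n" and c1: "c 1 = 1"
    and q: "prime q" "\<not> q dvd m" "m > 0"
  shows "(\<Sum>d | d dvd q ^ k * m. c d) = (\<Sum>i\<le>k. c q ^ i) * (\<Sum>d | d dvd m. c d)"
proof -
  have q0: "q > 0" using q(1) by (rule prime_gt_0_nat)
  have bij: "bij_betw (\<lambda>(i, d). q ^ i * d) ({..k} \<times> {d. d dvd m}) {d. d dvd q ^ k * m}"
  proof (rule bij_betw_imageI)
    show "inj_on (\<lambda>(i, d). q ^ i * d) ({..k} \<times> {d. d dvd m})"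
    proof (rule inj_onI, clarsimp)
      fix i d j e assume d: "d dvd m" "e dvd m" and eq: "q ^ i * d = q ^ j * e"
      have nd: "\<not> q dvd d" "\<not> q dvd e" using d q(2) dvd_trans by blast+
      have d0: "d \<noteq> 0" "e \<noteq> 0" using d q(3) by auto
      have "multiplicity q (q ^ i * d) = i" "multiplicity q (q ^ j * e) = j"
        using q(1) nd d0 by (simp_all add: prime_elem_multiplicity_mult_distrib not_dvd_imp_multiplicity_0)
      hence "i = j" using eq by simp
      thus "i = j \<and> d = e" using eq q0 by simp
    qed
    show "(\<lambda>(i, d). q ^ i * d) ` ({..k} \<times> {d. d dvd m}) = {d. d dvd q ^ k * m}"
    proof (intro equalityI subsetI)
      fix a assume "a \<in> (\<lambda>(i, d). q ^ i * d) ` ({..k} \<times> {d. d dvd m})"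
      then obtain i d where "a = q ^ i * d" "i \<le> k" "d dvd m" by auto
      thus "a \<in> {d. d dvd q ^ k * m}" by (simp add: mult_dvd_mono le_imp_power_dvd)
    next
      fix a assume "a \<in> {d. d dvd q ^ k * m}"
      hence "a dvd q ^ k * m" by simp
      then obtain b d where bd: "a = b * d" "b dvd q ^ k" "d dvd m" using division_decomp by blast
      then obtain i where "i \<le> k" "b = q ^ i" using divides_primepow_nat[OF q(1)] by blast
      thus "a \<in> (\<lambda>(i, d). q ^ i * d) ` ({..k} \<times> {d. d dvd m})" using bd by auto
    qed
  qed
  have "(\<Sum>d | d dvd q ^ k * m. c d) = (\<Sum>x\<in>{..k} \<times> {d. d dvd m}. c (case x of (i, d) \<Rightarrow> q ^ i * d))"
    by (rule sum.reindex_bij_betw[OF bij, symmetric])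
  also have "\<dots> = (\<Sum>(i, d)\<in>{..k} \<times> {d. d dvd m}. c q ^ i * c d)"
    by (intro sum.cong) (auto simp: mult completely_mult_power[OF mult c1])
  also have "\<dots> = (\<Sum>i\<le>k. c q ^ i) * (\<Sum>d | d dvd m. c d)"
    by (simp add: sum_product sum.cartesian_product)
  finally show ?thesis .
qed

lemma sum_powers_sign_value:
  fixes v :: real
  assumes "v \<in> {-1, 0, 1}"
  shows "(\<Sum>i\<le>k. v ^ i) \<ge> 0" and "even k \<Longrightarrow> (\<Sum>i\<le>k. v ^ i) \<ge> 1"
proof -
  have m1: "(\<Sum>i\<le>k. (-1) ^ i) = (if even k then 1 else (0::real))" by (induction k) auto
  have z: "(\<Sum>i\<le>k. 0 ^ i) = (1::real)" by (induction k) auto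
  show "(\<Sum>i\<le>k. v ^ i) \<ge> 0" using assms m1 z by auto
  show "(\<Sum>i\<le>k. v ^ i) \<ge> 1" if "even k" using assms m1 z that by auto
qed

text \<open>
  These divisor sums are the coefficients of the product of the zeta series with the series
  of \<open>c\<close>. They are multiplicative, and at the prime power \<open>q\<^sup>k\<close> equal the sum of \<open>(c q)\<^sup>i\<close> for \<open>i \<le> k\<close>, which is non-negative and at least 1 for even \<open>k\<close>.
\<close>

lemma sum_divisors_real_character:
  fixes c :: "nat \<Rightarrow> real"
  assumes mult: "\<And>m n. c (m * n) = c m * c n" and c1: "c 1 = 1" and val: "\<And>n. c n \<in> {-1, 0, 1}"
    and n: "n > 0"
  shows "(\<Sum>d | d dvd n. c d) \<ge> 0" and "(\<Sum>d | d dvd n\<^sup>2. c d) \<ge> 1"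
proof -
  have d1: "{d::nat. d dvd 1} = {1}" by auto
  show "(\<Sum>d | d dvd n. c d) \<ge> 0" using n
  proof (induction n rule: coprime_prime_power_induct)
    case one
    show ?case unfolding d1 using c1 by simp
  next
    case (prime_power q k m)
    show ?case
      unfolding sum_divisors_prime_power_mult[OF mult c1 prime_power(1-3)]
      by (rule mult_nonneg_nonneg[OF sum_powers_sign_value(1)[OF val] prime_power(4)])
  qed
  show "(\<Sum>d | d dvd n\<^sup>2. c d) \<ge> 1" using n
  proof (induction n rule: coprime_prime_power_induct)
    case one
    have "(1::nat)\<^sup>2 = 1" by simp
    thus ?case using d1 c1 by simp
  next
    case (prime_power q k m)
    have "\<not> q dvd m\<^sup>2" using prime_power(1,2) by (simp add: prime_dvd_power_iff)
    moreover have "m\<^sup>2 > 0" using prime_power(3) by simp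
    ultimately have "(\<Sum>d | d dvd q ^ (k * 2) * m\<^sup>2. c d) = (\<Sum>i\<le>k * 2. c q ^ i) * (\<Sum>d | d dvd m\<^sup>2. c d)"
      by (rule sum_divisors_prime_power_mult[OF mult c1 prime_power(1)])
    moreover have "1 * 1 \<le> (\<Sum>i\<le>k * 2. c q ^ i) * (\<Sum>d | d dvd m\<^sup>2. c d)"
    proof (rule mult_mono)
      show "1 \<le> (\<Sum>i\<le>k * 2. c q ^ i)" by (rule sum_powers_sign_value(2)[OF val]) simp
      thus "0 \<le> (\<Sum>i\<le>k * 2. c q ^ i)" by linarith
      show "1 \<le> (\<Sum>d | d dvd m\<^sup>2. c d)" by (rule prime_power(4))
    qed simp
    moreover have "(q ^ k * m)\<^sup>2 = q ^ (k * 2) * m\<^sup>2" by (simp only: power_mult_distrib power_mult)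
    ultimately show ?case by simp
  qed
qed

text \<open>
  Collecting the terms of the Lambert series by the exponent \<open>m = d * k\<close>. Working with the finite sum
  \<open>m \<le> N\<close> avoids a double infinite series; the error is controlled by the next lemma.
\<close>

lemma lambert_rearrange:
  fixes c :: "nat \<Rightarrow> real" and x :: real
  shows "(\<Sum>m=1..N. (\<Sum>d | d dvd m. c d) * x ^ m) = (\<Sum>d=1..N. c d * (\<Sum>k=1..N div d. x ^ (d * k)))"
proof -
  have "(\<Sum>m=1..N. (\<Sum>d | d dvd m. c d) * x ^ m) = (\<Sum>m=1..N. \<Sum>d | d \<in> {1..N} \<and> d dvd m. c d * x ^ m)"
  proof (rule sum.cong[OF refl])
    fix m assume m: "m \<in> {1..N}"
    have "{d. d \<in> {1..N} \<and> d dvd m} = {d. d dvd m}"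
    proof (intro equalityI subsetI)
      fix d assume "d \<in> {d. d dvd m}"
      hence d: "d dvd m" by simp
      have "d \<le> m" by (rule dvd_imp_le[OF d]) (use m in simp)
      moreover have "d > 0" by (rule dvd_pos_nat[OF _ d]) (use m in simp)
      ultimately show "d \<in> {d. d \<in> {1..N} \<and> d dvd m}" using d m by simp
    qed simp
    thus "(\<Sum>d | d dvd m. c d) * x ^ m = (\<Sum>d | d \<in> {1..N} \<and> d dvd m. c d * x ^ m)"
      by (simp only: sum_distrib_right)
  qed
  also have "\<dots> = (\<Sum>d=1..N. \<Sum>m | m \<in> {1..N} \<and> d dvd m. c d * x ^ m)"
    by (rule sum.swap_restrict) auto
  also have "\<dots> = (\<Sum>d=1..N. c d * (\<Sum>k=1..N div d. x ^ (d * k)))"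
  proof (rule sum.cong[OF refl])
    fix d assume "d \<in> {1..N}"
    hence d: "d > 0" by simp
    have "inj_on (\<lambda>k. d * k) {1..N div d}" using d by (simp add: inj_on_def)
    thus "(\<Sum>m | m \<in> {1..N} \<and> d dvd m. c d * x ^ m) = c d * (\<Sum>k=1..N div d. x ^ (d * k))"
      unfolding multiples_eq[OF d] by (simp add: sum.reindex sum_distrib_left)
  qed
  finally show ?thesis .
qed

lemma lambert_tail:
  fixes x :: real and d N :: nat
  assumes x: "0 < x" "x < 1" and d: "d > 0"
  shows "\<bar>x ^ d / (1 - x ^ d) - (\<Sum>k=1..N div d. x ^ (d * k))\<bar> \<le> x ^ N / (1 - x)"
proof -
  have xd: "x ^ d < 1" "x ^ d > 0" "x ^ d \<le> x"
    using x d power_decreasing[of 1 d x] by (auto simp: power_Suc_less_one power_less_one_iff)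
  have eq: "x ^ d / (1 - x ^ d) - (\<Sum>k=1..K. x ^ (d * k)) = x ^ (d * (K + 1)) / (1 - x ^ d)" for K
  proof (induction K)
    case 0
    show ?case by simp
  next
    case (Suc K)
    have "x ^ d / (1 - x ^ d) - (\<Sum>k=1..Suc K. x ^ (d * k)) = x ^ (d * (K + 1)) / (1 - x ^ d) - x ^ (d * (K + 1))"
      using Suc.IH by simp
    also have "\<dots> = (x ^ (d * (K + 1)) * x ^ d) / (1 - x ^ d)" using xd by (simp add: field_simps)
    also have "x ^ (d * (K + 1)) * x ^ d = x ^ (d * (Suc K + 1))" by (simp add: power_add[symmetric] algebra_simps)
    finally show ?case .
  qed
  have "N < d * (N div d + 1)" using d dividend_less_times_div[of d N] by simp
  hence "x ^ (d * (N div d + 1)) \<le> x ^ N" using x by (intro power_decreasing) auto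
  hence "x ^ (d * (N div d + 1)) / (1 - x ^ d) \<le> x ^ N / (1 - x)" using x xd by (intro frac_le) auto
  moreover have "x ^ (d * (N div d + 1)) / (1 - x ^ d) \<ge> 0" using x xd by simp
  ultimately show ?thesis unfolding eq by (simp only: abs_of_nonneg)
qed

text \<open>
  Of the coefficients of the power series only those at the squares up to \<open>J\<^sup>2\<close> are kept. As \<open>N\<close>
  grows, the correction tends to 0, and as \<open>x\<close> tends to 1 the main term tends to \<open>J\<close>: the Lambert
  series is unbounded near 1.
\<close>

lemma lambert_partial_lower_bound:
  fixes c :: "nat \<Rightarrow> real" and x :: real
  assumes mult: "\<And>m n. c (m * n) = c m * c n" and c1: "c 1 = 1" and val: "\<And>n. c n \<in> {-1, 0, 1}"
    and x: "0 < x" "x < 1" and N: "J\<^sup>2 \<le> N"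
  shows "real J * x ^ J\<^sup>2 - real N * (x ^ N / (1 - x)) \<le> (\<Sum>d=1..N. c d * (x ^ d / (1 - x ^ d)))"
proof -
  let ?r = "\<lambda>m. \<Sum>d | d dvd m. c d"
  have r0: "?r m \<ge> 0" if "m > 0" for m by (rule sum_divisors_real_character(1)[OF mult c1 val that])
  have "real J * x ^ J\<^sup>2 = (\<Sum>j=1..J. x ^ J\<^sup>2)" by simp
  also have "\<dots> \<le> (\<Sum>j=1..J. ?r (j\<^sup>2) * x ^ j\<^sup>2)"
  proof (rule sum_mono)
    fix j assume j: "j \<in> {1..J}"
    have "x ^ J\<^sup>2 \<le> x ^ j\<^sup>2" using x j by (intro power_decreasing power_mono) auto
    also have "\<dots> = 1 * x ^ j\<^sup>2" by simp
    also have "\<dots> \<le> ?r (j\<^sup>2) * x ^ j\<^sup>2"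
      using x j by (intro mult_right_mono sum_divisors_real_character(2)[OF mult c1 val]) auto
    finally show "x ^ J\<^sup>2 \<le> ?r (j\<^sup>2) * x ^ j\<^sup>2" .
  qed
  also have "\<dots> = (\<Sum>m\<in>(\<lambda>j. j\<^sup>2) ` {1..J}. ?r m * x ^ m)"
    by (subst sum.reindex) (auto simp: inj_on_def)
  also have "\<dots> \<le> (\<Sum>m=1..N. ?r m * x ^ m)"
  proof (rule sum_mono2)
    show "(\<lambda>j. j\<^sup>2) ` {1..J} \<subseteq> {1..N}"
    proof
      fix m assume "m \<in> (\<lambda>j. j\<^sup>2) ` {1..J}"
      then obtain j where j: "m = j\<^sup>2" "j \<in> {1..J}" by (rule imageE)
      have "j\<^sup>2 \<le> J\<^sup>2" using j by (intro power_mono) auto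
      moreover have "j\<^sup>2 \<ge> 1" using j by simp
      ultimately show "m \<in> {1..N}" unfolding j(1) atLeastAtMost_iff using N by linarith
    qed
    show "0 \<le> ?r m * x ^ m" if "m \<in> {1..N} - (\<lambda>j. j\<^sup>2) ` {1..J}" for m
      using that x by (intro mult_nonneg_nonneg r0) auto
  qed simp
  also have "\<dots> = (\<Sum>d=1..N. c d * (\<Sum>k=1..N div d. x ^ (d * k)))" by (rule lambert_rearrange)
  also have "\<dots> \<le> (\<Sum>d=1..N. c d * (x ^ d / (1 - x ^ d)) + x ^ N / (1 - x))"
  proof (rule sum_mono)
    fix d assume "d \<in> {1..N}"
    hence d: "d > 0" by simp
    let ?a = "x ^ d / (1 - x ^ d)" and ?b = "\<Sum>k=1..N div d. x ^ (d * k)"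
    have "\<bar>c d\<bar> \<le> 1" using val[of d] by auto
    hence "\<bar>c d * (?b - ?a)\<bar> \<le> 1 * \<bar>?b - ?a\<bar>" unfolding abs_mult by (rule mult_right_mono) simp
    also have "\<dots> \<le> x ^ N / (1 - x)"
      using lambert_tail[OF x d, of N] by (simp only: mult_1_left abs_minus_commute)
    finally have "c d * (?b - ?a) \<le> x ^ N / (1 - x)" by linarith
    thus "c d * ?b \<le> c d * ?a + x ^ N / (1 - x)" unfolding right_diff_distrib by linarith
  qed
  also have "\<dots> = (\<Sum>d=1..N. c d * (x ^ d / (1 - x ^ d))) + real N * (x ^ N / (1 - x))"
    by (simp add: sum.distrib)
  finally show ?thesis by linarith
qed

text \<open>
  Arithmetic-geometric mean inequality for the pairs \<open>i\<close> and \<open>n - 1 - i\<close>.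
\<close>

lemma geometric_sum_ge:
  fixes y :: real
  assumes y: "0 \<le> y"
  shows "real n * y ^ (n - 1) \<le> (\<Sum>i<n. (y\<^sup>2) ^ i)"
proof -
  let ?S = "\<Sum>i<n. (y\<^sup>2) ^ i"
  have "(\<Sum>i<n. 2 * y ^ (n - 1)) \<le> (\<Sum>i<n. (y\<^sup>2) ^ i + (y\<^sup>2) ^ (n - 1 - i))"
  proof (rule sum_mono)
    fix i assume "i \<in> {..<n}"
    hence "n - 1 = i + (n - 1 - i)" by simp
    hence "y ^ (n - 1) = y ^ i * y ^ (n - 1 - i)" by (metis power_add)
    moreover have "2 * (y ^ i * y ^ (n - 1 - i)) \<le> (y ^ i)\<^sup>2 + (y ^ (n - 1 - i))\<^sup>2"
      using sum_squares_bound[of "y ^ i" "y ^ (n - 1 - i)"] by simp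
    ultimately show "2 * y ^ (n - 1) \<le> (y\<^sup>2) ^ i + (y\<^sup>2) ^ (n - 1 - i)"
      by (simp add: power_mult[symmetric] mult.commute)
  qed
  also have "\<dots> = ?S + (\<Sum>i<n. (y\<^sup>2) ^ (n - 1 - i))" by (rule sum.distrib)
  also have "(\<Sum>i<n. (y\<^sup>2) ^ (n - 1 - i)) = ?S"
    using sum.nat_diff_reindex[of "\<lambda>i. (y\<^sup>2) ^ i" n] by simp
  finally show ?thesis by simp
qed

text \<open>
  The first fraction is the behaviour of the second one as \<open>x\<close> tends to 1. At \<open>n = 0\<close> both vanish by
  the convention for division by 0, which is the value \<open>variation_of_hump\<close> asks for.
\<close>

definition monsky_weight :: "real \<Rightarrow> nat \<Rightarrow> real" where
  "monsky_weight x n = 1 / (real n * (1 - x)) - x ^ n / (1 - x ^ n)"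

lemma monsky_decreasing:
  fixes x :: real
  assumes x: "0 < x" "x < 1" and n: "n \<ge> 1"
  shows "monsky_weight x (Suc n) \<le> monsky_weight x n"
proof -
  define G where "G = (\<lambda>n. \<Sum>i<n. x ^ i)"
  define y where "y = sqrt x"
  have y: "0 \<le> y" "y \<le> 1" "y\<^sup>2 = x" using x by (simp_all add: y_def)
  have G: "1 - x ^ k = (1 - x) * G k" for k
    unfolding G_def using one_diff_power_eq[of x k] by simp
  have Gpos: "G k > 0" if "k \<ge> 1" for k
  proof -
    have "x ^ k < 1" using x that by (simp add: power_less_one_iff)
    hence "(1 - x) * G k > 0" unfolding G[symmetric] by simp
    thus ?thesis using x by (simp add: zero_less_mult_iff)
  qed
  have GG: "real n * real (Suc n) * x ^ n \<le> G n * G (Suc n)"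
  proof -
    have "real n * y ^ (n - 1) \<le> G n" unfolding G_def y(3)[symmetric] by (rule geometric_sum_ge[OF y(1)])
    moreover have "real (Suc n) * y ^ (Suc n - 1) \<le> G (Suc n)"
      unfolding G_def y(3)[symmetric] by (rule geometric_sum_ge[OF y(1)])
    ultimately have "(real n * y ^ (n - 1)) * (real (Suc n) * y ^ (Suc n - 1)) \<le> G n * G (Suc n)"
      using y Gpos[of n] n by (intro mult_mono) auto
    moreover have "x ^ n \<le> y ^ (n - 1) * y ^ (Suc n - 1)"
    proof -
      have "x ^ n = y ^ (2 * n)" unfolding power_mult y(3) ..
      also have "\<dots> \<le> y ^ ((n - 1) + (Suc n - 1))" using y by (intro power_decreasing) auto
      finally show ?thesis by (simp only: power_add)
    qed
    hence "(real n * real (Suc n)) * x ^ n \<le> (real n * real (Suc n)) * (y ^ (n - 1) * y ^ (Suc n - 1))"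
      by (rule mult_left_mono) simp
    ultimately show ?thesis by (simp only: mult_ac) 
  qed
  \<comment> \<open>With \<open>G\<close> denoting the geometric sums, monotonicity reduces to \<open>n (n + 1) x ^ n \<le> G n * G (Suc n)\<close>.\<close>
  have m: "monsky_weight x k = (1 / real k - x ^ k / G k) / (1 - x)" for k
    unfolding monsky_weight_def G by (simp add: diff_divide_distrib mult.commute)
  have GS: "G (Suc n) = 1 + x * G n" unfolding G_def sum.lessThan_Suc_shift sum_distrib_left by simp
  have gp: "G n > 0" "G (Suc n) > 0" using Gpos n by auto
  have "x ^ n / G n - x ^ Suc n / G (Suc n) = (x ^ n * G (Suc n) - x ^ Suc n * G n) / (G n * G (Suc n))"
    using gp by (simp add: diff_frac_eq)
  also have "x ^ n * G (Suc n) - x ^ Suc n * G n = x ^ n" unfolding GS by (simp add: algebra_simps)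
  also have "x ^ n / (G n * G (Suc n)) \<le> 1 / (real n * real (Suc n))"
  proof -
    have "x ^ n * (real n * real (Suc n)) \<le> 1 * (G n * G (Suc n))" using GG by (simp only: mult_1_left mult.commute)
    moreover have "real n * real (Suc n) > 0" "G n * G (Suc n) > 0" using gp n by simp_all
    ultimately show ?thesis by (simp only: pos_divide_le_eq) (simp add: pos_le_divide_eq field_simps)
  qed
  also have "\<dots> = 1 / real n - 1 / real (Suc n)" using n by (simp add: field_simps)
  finally have "1 / real (Suc n) - x ^ Suc n / G (Suc n) \<le> 1 / real n - x ^ n / G n" by linarith
  thus ?thesis unfolding m using x by (intro divide_right_mono) auto
qed

lemma monsky_tendsto_0:
  fixes x :: real
  assumes x: "0 < x" "x < 1"
  shows "monsky_weight x \<longlonglongrightarrow> 0"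
proof -
  have p: "(\<lambda>n. x ^ n) \<longlonglongrightarrow> 0" using x by (intro LIMSEQ_realpow_zero) auto
  have "(\<lambda>n. x ^ n / (1 - x ^ n)) \<longlonglongrightarrow> 0 / (1 - 0)"
    by (intro tendsto_divide tendsto_diff tendsto_const p) simp
  moreover have "(\<lambda>n. 1 / real n * (1 / (1 - x))) \<longlonglongrightarrow> 0 * (1 / (1 - x))"
    by (intro tendsto_mult tendsto_const lim_1_over_n)
  ultimately have "(\<lambda>n. 1 / real n * (1 / (1 - x)) - x ^ n / (1 - x ^ n)) \<longlonglongrightarrow> 0 * (1 / (1 - x)) - 0 / (1 - 0)"
    by (intro tendsto_diff)
  thus ?thesis unfolding monsky_weight_def by simp
qed

text \<open>
  Monsky's argument. If \<open>L(1) = 0\<close>, then the Lambert series \<open>\<Sum> c n x\<^sup>n / (1 - x\<^sup>n)\<close> is, up to sign,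
  the sum of the \<open>c n\<close> with the weights above. These decrease from 1 to 0, so partial summation bounds the series
  uniformly in \<open>x\<close>. But its coefficients as a power series are non-negative and at least 1 at all squares,
  so it is unbounded as \<open>x\<close> tends to 1.
\<close>

lemma real_character_L1_nonzero:
  fixes c :: "nat \<Rightarrow> real"
  assumes mult: "\<And>m n. c (m * n) = c m * c n" and c1: "c 1 = 1" and val: "\<And>n. c n \<in> {-1, 0, 1}"
    and S: "\<And>n. norm (\<Sum>k<n. c k) \<le> M"
  shows "dirichlet_L c 1 \<noteq> 0"
proof
  assume L0: "dirichlet_L c 1 = 0"
  have p1: "real n powr - 1 = 1 / real n" for n
    by (cases "n = 0") (simp_all add: powr_neg_one)
  have Ls: "(\<lambda>n. 1 / real n * c n) sums 0"
    using summable_sums[OF dirichlet_L_bounded(1)[OF S zero_less_one]] L0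
    unfolding dirichlet_L_def p1 by (simp add: scaleR_conv_of_real)
  have key: "real J * x ^ J\<^sup>2 \<le> 2 * M" if x: "0 < x" "x < 1" for x J
  proof -
    have "monsky_weight x 0 = 0" by (simp add: monsky_weight_def)
    hence var: "(\<lambda>k. \<bar>monsky_weight x (Suc k) - monsky_weight x k\<bar>) sums (2 * monsky_weight x 1)"
      by (rule variation_of_hump) (use monsky_decreasing[OF x] monsky_tendsto_0[OF x] in auto)
    have "monsky_weight x 1 = 1 / (1 - x) - x / (1 - x)" by (simp add: monsky_weight_def)
    also have "\<dots> = (1 - x) / (1 - x)" by (rule diff_divide_distrib[symmetric])
    also have "\<dots> = 1" using x by simp
    finally have m1: "monsky_weight x 1 = 1" .
    note T = dirichlet_test_variation[OF S monsky_tendsto_0[OF x] sums_summable[OF var]]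
    have "norm (\<Sum>k. monsky_weight x k *\<^sub>R c k) \<le> 2 * M"
      using T(2) sums_unique[OF var] m1 by (simp add: mult.commute)
    hence le: "- (\<Sum>k. monsky_weight x k *\<^sub>R c k) \<le> 2 * M" unfolding real_norm_def by linarith
    have "(\<lambda>n. 1 / (1 - x) * (1 / real n * c n) - monsky_weight x n *\<^sub>R c n) sums
        (1 / (1 - x) * 0 - (\<Sum>k. monsky_weight x k *\<^sub>R c k))"
      by (intro sums_diff sums_mult Ls summable_sums T(1))
    moreover have "1 / (1 - x) * (1 / real n * c n) - monsky_weight x n *\<^sub>R c n = c n * (x ^ n / (1 - x ^ n))" for n
      by (simp add: monsky_weight_def algebra_simps)
    ultimately have "(\<lambda>n. c n * (x ^ n / (1 - x ^ n))) sums (- (\<Sum>k. monsky_weight x k *\<^sub>R c k))"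
      by simp
    hence "(\<lambda>N. \<Sum>n\<le>N. c n * (x ^ n / (1 - x ^ n))) \<longlonglongrightarrow> - (\<Sum>k. monsky_weight x k *\<^sub>R c k)"
      by (simp only: sums_def_le)
    moreover have "(\<Sum>n\<le>N. c n * (x ^ n / (1 - x ^ n))) = (\<Sum>d=1..N. c d * (x ^ d / (1 - x ^ d)))" for N
    proof -
      have "{..N} = insert 0 {1..N}" by auto
      thus ?thesis by simp
    qed
    ultimately have lim: "(\<lambda>N. \<Sum>d=1..N. c d * (x ^ d / (1 - x ^ d))) \<longlonglongrightarrow> - (\<Sum>k. monsky_weight x k *\<^sub>R c k)"
      by simp
    \<comment> \<open>The correction term of the partial lower bound vanishes as \<open>N\<close> grows, for fixed \<open>x\<close>.\<close>
    have "(\<lambda>N. real N * x ^ N * (1 / (1 - x))) \<longlonglongrightarrow> 0 * (1 / (1 - x))"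
      using x by (intro tendsto_mult tendsto_const powser_times_n_limit_0) auto
    hence "(\<lambda>N. real J * x ^ J\<^sup>2 - real N * (x ^ N / (1 - x))) \<longlonglongrightarrow> real J * x ^ J\<^sup>2 - 0"
      by (intro tendsto_diff tendsto_const) simp
    hence "real J * x ^ J\<^sup>2 - 0 \<le> - (\<Sum>k. monsky_weight x k *\<^sub>R c k)"
      by (rule LIMSEQ_le[OF _ lim])
         (intro exI[of _ "J\<^sup>2"] allI impI lambert_partial_lower_bound[OF mult c1 val x])
    with le show ?thesis by linarith
  qed
  obtain J :: nat where J: "real J > 2 * M" using reals_Archimedean2 by blast
  have "(\<lambda>n. 1 - 1 / real (n + 2)) \<longlonglongrightarrow> 1 - 0"
    by (intro tendsto_diff tendsto_const LIMSEQ_ignore_initial_segment lim_1_over_n)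
  hence "(\<lambda>n. real J * (1 - 1 / real (n + 2)) ^ J\<^sup>2) \<longlonglongrightarrow> real J * (1 - 0) ^ J\<^sup>2"
    by (intro tendsto_mult tendsto_power tendsto_const)
  hence "real J * (1 - 0) ^ J\<^sup>2 \<le> 2 * M"
    by (rule LIMSEQ_le_const2) (intro exI[of _ 0] allI impI key, auto)
  with J show False by simp
qed

section \<open>Characters modulo a prime\<close>

text \<open>
  Full periods cancel, and fewer than \<open>p\<close> terms of an incomplete period remain.
\<close>

lemma periodic_partial_sums_bounded:
  fixes c :: "nat \<Rightarrow> complex"
  assumes per: "\<And>n. c (n + p) = c n" and zero: "(\<Sum>r<p. c r) = 0" and bd: "\<And>n. norm (c n) \<le> 1"
    and p: "p > 0"
  shows "norm (\<Sum>k<n. c k) \<le> real p"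
proof -
  have "(\<Sum>k<n + p. c k) = (\<Sum>k<n. c k)" for n
  proof -
    have "(\<Sum>k<n + p. c k) = (\<Sum>k<p. c k) + (\<Sum>k<n. c (k + p))"
      by (induction n) (simp_all add: add.assoc)
    thus ?thesis using zero per by simp
  qed
  hence add: "(\<Sum>k<r + q * p. c k) = (\<Sum>k<r. c k)" for q r
  proof (induction q)
    case (Suc q)
    have "r + Suc q * p = (r + q * p) + p" by simp
    with Suc show ?case by (simp only:)
  qed simp
  have "n mod p + n div p * p = n" by (rule mod_div_mult_eq)
  hence "(\<Sum>k<n. c k) = (\<Sum>k<n mod p. c k)" using add[where r = "n mod p" and q = "n div p"] by (simp only:)
  also have "norm \<dots> \<le> (\<Sum>k<n mod p. 1)" using bd by (intro sum_norm_le) simp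
  also have "\<dots> \<le> real p" using p by (simp add: less_imp_le)
  finally show ?thesis .
qed

text \<open>
  Modulo a prime the characters are explicit: the powers of one root of unity, composed with the
  discrete logarithm to the base of a primitive root. Only \<open>j < p - 1\<close> is of interest for
  \<open>chi j\<close>, and \<open>chi 0\<close> is the principal character.
\<close>

locale prime_characters =
  fixes p g :: nat
  assumes prime_p: "prime p" and primroot: "residue_primroot p g"
begin

definition \<zeta> :: complex where "\<zeta> = cis (2 * pi / real (p - 1))"

definition dlog :: "nat \<Rightarrow> nat" where
  "dlog n = (THE i. i < p - 1 \<and> g ^ i mod p = n mod p)"

definition chi :: "nat \<Rightarrow> nat \<Rightarrow> complex" where
  "chi j n = (if p dvd n then 0 else \<zeta> ^ (j * dlog n))"

lemma p_gt_1: "p > 1" and p_gt_0: "p > 0" and p1_gt_0: "p - 1 > 0"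
proof -
  show "p > 1" using prime_p by (rule prime_gt_1_nat)
  thus "p > 0" "p - 1 > 0" by linarith+
qed

lemma bij_primroot: "bij_betw (\<lambda>i. g ^ i mod p) {..<p - 1} {0<..<p}"
  using residue_primroot_is_generator[OF p_gt_1 primroot]
  unfolding totatives_prime[OF prime_p] totient_prime[OF prime_p] .

lemma dlog:
  assumes "\<not> p dvd n"
  shows "dlog n < p - 1" and "g ^ dlog n mod p = n mod p"
proof -
  have "n mod p \<in> {0<..<p}" 
    unfolding greaterThanLessThan_iff mod_greater_zero_iff_not_dvd using assms p_gt_0 by simp
  hence "n mod p \<in> (\<lambda>i. g ^ i mod p) ` {..<p - 1}" 
    unfolding bij_betw_imp_surj_on[OF bij_primroot] .
  then obtain i where i: "i < p - 1" "g ^ i mod p = n mod p" by auto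
  have unique: "i' = i" if i': "i' < p - 1 \<and> g ^ i' mod p = n mod p" for i'
  proof (rule inj_onD[OF bij_betw_imp_inj_on[OF bij_primroot]])
    show "g ^ i' mod p = g ^ i mod p" by (rule trans[OF conjunct2[OF i'] i(2)[symmetric]])
    show "i' \<in> {..<p - 1}" by (rule lessThan_iff[THEN iffD2, OF conjunct1[OF i']])
    show "i \<in> {..<p - 1}" by (rule lessThan_iff[THEN iffD2, OF i(1)])
  qed
  have "dlog n < p - 1 \<and> g ^ dlog n mod p = n mod p"
    unfolding dlog_def by (rule theI[of "\<lambda>i. i < p - 1 \<and> g ^ i mod p = n mod p", OF conjI[OF i] unique])
  thus "dlog n < p - 1" "g ^ dlog n mod p = n mod p" by (rule conjunct1, rule conjunct2)
qed

lemma zeta_power_period: "\<zeta> ^ (p - 1) = 1"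
proof -
  have "\<zeta> ^ (p - 1) = cis (real (p - 1) * (2 * pi / real (p - 1)))" unfolding \<zeta>_def by (rule Complex.DeMoivre)
  also have "real (p - 1) * (2 * pi / real (p - 1)) = 2 * pi" using p1_gt_0 by simp
  finally show ?thesis by simp
qed

lemma zeta_power_neq_1:
  assumes "0 < k" "k < p - 1"
  shows "\<zeta> ^ k \<noteq> 1"
proof
  assume "\<zeta> ^ k = 1"
  hence "cis (real k * (2 * pi / real (p - 1))) = 1" unfolding \<zeta>_def by (simp only: Complex.DeMoivre)
  from arg_cong[OF this, of Re] have "cos (real k * (2 * pi / real (p - 1))) = 1" by simp
  then obtain m :: int where "real k * (2 * pi / real (p - 1)) = of_int m * (2 * pi)"
    using cos_one_2pi_int[of "real k * (2 * pi / real (p - 1))"] by (auto simp: mult_ac)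
  hence "(real k / real (p - 1)) * (2 * pi) = of_int m * (2 * pi)"
    by (simp only: times_divide_eq_right times_divide_eq_left)
  moreover have "2 * pi \<noteq> 0" by simp
  ultimately have "real k / real (p - 1) = of_int m" by (simp only: mult_cancel_right simp_thms)
  moreover have "real (p - 1) \<noteq> 0" using p1_gt_0 by linarith
  ultimately have "real k = of_int m * real (p - 1)" by (simp only: divide_eq_eq if_True simp_thms)
  hence eq: "int k = m * int (p - 1)" by (metis of_int_eq_iff of_int_mult of_int_of_nat_eq)
  hence "m * int (p - 1) > 0" using assms by linarith
  hence "m > 0" using p1_gt_0 by (simp add: zero_less_mult_iff)
  hence "1 * int (p - 1) \<le> m * int (p - 1)" by (intro mult_right_mono) auto
  thus False using eq assms by simp
qed

lemma norm_zeta: "norm \<zeta> = 1" by (simp add: \<zeta>_def)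

lemma zeta_power_cong:
  assumes "g ^ a mod p = g ^ b mod p"
  shows "\<zeta> ^ a = \<zeta> ^ b"
proof -
  have co: "coprime p g" using primroot by (simp add: residue_primroot_def)
  have ord: "ord p g = p - 1" using primroot totient_prime[OF prime_p] by (simp add: residue_primroot_def)
  have "[g ^ a = g ^ b] (mod p)" using assms by (simp add: cong_def)
  hence "[a = b] (mod (p - 1))" using order_divides_expdiff[OF co, of a b] ord by simp
  hence "a mod (p - 1) = b mod (p - 1)" by (simp add: cong_def)
  moreover have red: "\<zeta> ^ n = \<zeta> ^ (n mod (p - 1))" for n
  proof -
    have "\<zeta> ^ n = \<zeta> ^ ((p - 1) * (n div (p - 1)) + n mod (p - 1))" by (simp only: mult_div_mod_eq)
    also have "\<dots> = \<zeta> ^ (n mod (p - 1))" by (simp only: power_add power_mult zeta_power_period power_one mult_1_left)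
    finally show ?thesis .
  qed
  ultimately show ?thesis by (metis red)
qed

lemma chi_mult: "chi j (m * n) = chi j m * chi j n"
proof (cases "p dvd m \<or> p dvd n")
  case True
  thus ?thesis by (auto simp: chi_def)
next
  case False
  hence mn: "\<not> p dvd m * n" using prime_p by (simp add: prime_dvd_mult_iff)
  have "g ^ dlog (m * n) mod p = (m * n) mod p" by (rule dlog(2)[OF mn])
  also have "\<dots> = ((m mod p) * (n mod p)) mod p" by (simp only: mod_mult_eq)
  also have "\<dots> = ((g ^ dlog m mod p) * (g ^ dlog n mod p)) mod p" using dlog(2) False by simp
  also have "\<dots> = g ^ (dlog m + dlog n) mod p" by (simp only: mod_mult_eq power_add)
  finally have "\<zeta> ^ dlog (m * n) = \<zeta> ^ (dlog m + dlog n)" by (rule zeta_power_cong)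
  hence "\<zeta> ^ (j * dlog (m * n)) = \<zeta> ^ (j * dlog m) * \<zeta> ^ (j * dlog n)"
    by (metis power_add power_mult mult.commute distrib_left)
  thus ?thesis using False mn by (simp add: chi_def)
qed

lemma dlog_1: "dlog 1 = 0"
proof -
  have nd: "\<not> p dvd 1" using p_gt_1 by simp
  have "\<zeta> ^ dlog 1 = \<zeta> ^ 0" by (rule zeta_power_cong) (use dlog(2)[OF nd] in simp)
  hence "\<zeta> ^ dlog 1 = 1" by simp
  thus ?thesis using zeta_power_neq_1[of "dlog 1"] dlog(1)[OF nd] by blast
qed

lemma chi_1: "chi j 1 = 1"
  using p_gt_1 by (simp add: chi_def dlog_1[simplified])

lemma chi_0: "chi j 0 = 0" by (simp add: chi_def)

lemma norm_chi_le: "norm (chi j n) \<le> 1"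
  by (simp add: chi_def norm_power norm_zeta)

lemma dlog_cong: "m mod p = n mod p \<Longrightarrow> dlog m = dlog n"
  by (simp add: dlog_def)

lemma chi_cong: "m mod p = n mod p \<Longrightarrow> chi j m = chi j n"
  unfolding chi_def dvd_eq_mod_eq_0 using dlog_cong[of m n] by simp

text \<open>
  For \<open>n\<close> prime to \<open>p\<close> this is a geometric sum with ratio \<open>\<zeta> ^ dlog n\<close>, an element of the group of
  \<open>p - 1\<close>-th roots of unity that is 1 only for \<open>n \<equiv> 1\<close>.
\<close>

lemma sum_chi_orthogonal:
  "(\<Sum>j<p - 1. chi j n) = (if n mod p = 1 then of_nat (p - 1) else 0)"
proof (cases "p dvd n")
  case True
  thus ?thesis by (auto simp: chi_def)
next
  case False
  have eq: "(\<Sum>j<p - 1. chi j n) = (\<Sum>j<p - 1. (\<zeta> ^ dlog n) ^ j)"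
    using False by (simp add: chi_def power_mult[symmetric] mult.commute)
  show ?thesis
  proof (cases "n mod p = 1")
    case True
    hence "n mod p = 1 mod p" using p_gt_1 by simp
    hence "dlog n = 0" using dlog_cong[of n 1] dlog_1 by simp
    thus ?thesis unfolding eq using True by simp
  next
    case n1: False
    have "dlog n \<noteq> 0"
    proof
      assume "dlog n = 0"
      hence "n mod p = 1" using dlog(2)[OF False] p_gt_1 by simp
      with n1 show False by simp
    qed
    hence w: "\<zeta> ^ dlog n \<noteq> 1" using dlog(1)[OF False] by (intro zeta_power_neq_1) auto
    have "(\<zeta> ^ dlog n) ^ (p - 1) = 1"
      by (metis power_mult mult.commute zeta_power_period power_one)
    hence "(\<Sum>j<p - 1. (\<zeta> ^ dlog n) ^ j) = 0" using w by (simp add: geometric_sum)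
    thus ?thesis unfolding eq using n1 by simp
  qed
qed

text \<open>
  Enumerating the non-zero residues as powers of the primitive root turns the sum into a geometric one.
\<close>

lemma sum_chi_residues:
  assumes j: "0 < j" "j < p - 1"
  shows "(\<Sum>r<p. chi j r) = 0"
proof -
  have "{..<p} = insert 0 {0<..<p}" using p_gt_0 by auto
  hence "(\<Sum>r<p. chi j r) = (\<Sum>r\<in>{0<..<p}. chi j r)" by (simp add: chi_0)
  also have "\<dots> = (\<Sum>i<p - 1. chi j (g ^ i mod p))"
    by (rule sum.reindex_bij_betw[OF bij_primroot, symmetric])
  also have "\<dots> = (\<Sum>i<p - 1. (\<zeta> ^ j) ^ i)"
  proof (rule sum.cong[OF refl])
    fix i assume "i \<in> {..<p - 1}"
    hence "g ^ i mod p \<in> {0<..<p}" by (rule bij_betw_apply[OF bij_primroot])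
    hence "0 < g ^ i mod p" "g ^ i mod p < p" by simp_all
    hence nd: "\<not> p dvd (g ^ i mod p)" by (rule nat_dvd_not_less)
    have "\<zeta> ^ dlog (g ^ i mod p) = \<zeta> ^ i"
      by (rule zeta_power_cong) (use dlog(2)[OF nd] in simp)
    hence "\<zeta> ^ (j * dlog (g ^ i mod p)) = (\<zeta> ^ j) ^ i" by (metis power_mult mult.commute)
    thus "chi j (g ^ i mod p) = (\<zeta> ^ j) ^ i" using nd by (simp add: chi_def)
  qed
  also have "\<dots> = 0"
  proof -
    have "(\<zeta> ^ j) ^ (p - 1) = 1" by (metis power_mult mult.commute zeta_power_period power_one)
    thus ?thesis using zeta_power_neq_1[OF j] by (simp add: geometric_sum)
  qed
  finally show ?thesis .
qed

lemma sum_chi_bounded: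
  assumes j: "0 < j" "j < p - 1"
  shows "norm (\<Sum>k<n. chi j k) \<le> real p"
  by (rule periodic_partial_sums_bounded[OF chi_cong sum_chi_residues[OF j] norm_chi_le p_gt_0]) simp

lemma chi_conjugate:
  assumes j: "j < p - 1"
  shows "chi (p - 1 - j) n = cnj (chi j n)"
proof (cases "p dvd n")
  case False
  have "\<zeta> ^ ((p - 1 - j) * dlog n) * \<zeta> ^ (j * dlog n) = \<zeta> ^ ((p - 1) * dlog n)"
    unfolding power_add[symmetric] add_mult_distrib[symmetric] using j by simp
  also have "\<dots> = 1" by (simp only: power_mult zeta_power_period power_one)
  finally have "\<zeta> ^ ((p - 1 - j) * dlog n) * \<zeta> ^ (j * dlog n) = 1" .
  moreover have "cnj (\<zeta> ^ (j * dlog n)) * \<zeta> ^ (j * dlog n) = 1"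
    using complex_norm_square[of "\<zeta> ^ (j * dlog n)"] by (simp add: norm_power norm_zeta mult.commute)
  ultimately have "\<zeta> ^ ((p - 1 - j) * dlog n) * \<zeta> ^ (j * dlog n) = cnj (\<zeta> ^ (j * dlog n)) * \<zeta> ^ (j * dlog n)"
    by (simp only:)
  moreover have "\<zeta> ^ (j * dlog n) \<noteq> 0" using norm_zeta by auto
  ultimately have "\<zeta> ^ ((p - 1 - j) * dlog n) = cnj (\<zeta> ^ (j * dlog n))" by (simp only: mult_cancel_right simp_thms)
  thus ?thesis using False by (simp add: chi_def)
qed (simp add: chi_def)

lemma chi_real_values:
  assumes "2 * j = p - 1"
  shows "chi j n \<in> {-1, 0, 1}"
proof -
  have "(\<zeta> ^ j)\<^sup>2 = 1" by (metis assms mult.commute power_mult zeta_power_period)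
  hence "\<zeta> ^ j \<in> {-1, 1}" by (auto simp: power2_eq_1_iff)
  hence "(\<zeta> ^ j) ^ i \<in> {-1, 1}" for i by (induction i) auto
  thus ?thesis by (auto simp: chi_def power_mult)
qed

end

section \<open>Primes congruent to -1 modulo a prime\<close>

text \<open>
  For completely multiplicative \<open>c\<close> bounded by 1 and \<open>s > 1\<close>, up to a bounded error, this is \<open>ln \<bar>L(s)\<bar>\<close>, by \<open>dirichlet_L_prime_sum\<close>.
\<close>

definition prime_sum :: "(nat \<Rightarrow> complex) \<Rightarrow> real \<Rightarrow> real" where
  "prime_sum c s = (\<Sum>q. if prime q then real q powr - s * Re (c q) else 0)"

lemma prime_sum_summable:
  assumes bd: "\<And>n. norm (c n) \<le> 1" and s: "s > 1"
  shows "summable (\<lambda>q. if prime q then real q powr - s * Re (c q) else 0)"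
proof (rule summable_comparison_test'[where N = 0])
  show "summable (\<lambda>q. real q powr - s)" using s by (simp add: summable_real_powr_iff)
  fix q :: nat
  have "\<bar>Re (c q)\<bar> \<le> 1" using abs_Re_le_cmod[of "c q"] bd[of q] by linarith
  hence "real q powr - s * \<bar>Re (c q)\<bar> \<le> real q powr - s * 1" by (rule mult_left_mono) simp
  thus "norm (if prime q then real q powr - s * Re (c q) else 0) \<le> real q powr - s"
    by (simp add: abs_mult)
qed

lemma dirichlet_L_prime_sum:
  fixes c :: "nat \<Rightarrow> complex"
  assumes mult: "\<And>m n. c (m * n) = c m * c n" and c1: "c 1 = 1" and c0: "c 0 = 0"
    and bd: "\<And>n. norm (c n) \<le> 1" and s: "s > 1"
  shows "exp (prime_sum c s - 4) \<le> norm (dirichlet_L c s)"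
    and "norm (dirichlet_L c s) \<le> exp (prime_sum c s + 4)"
proof -
  define f where "f = (\<lambda>n. (real n powr - s) *\<^sub>R c n)"
  have f: "f (m * n) = f m * f n" for m n
    by (simp add: f_def mult powr_mult scaleR_conv_of_real)
  have f01: "f 1 = 1" "f 0 = 0" by (simp_all add: f_def c1[simplified] c0)
  have nf: "norm (f n) \<le> real n powr - s" for n
    using mult_left_mono[OF bd[of n], of "real n powr - s"] by (simp add: f_def)
  have sm: "summable (\<lambda>n. norm (f n))"
    by (rule summable_comparison_test'[where N = 0 and g = "\<lambda>n. real n powr - s"])
       (use s nf in \<open>simp_all add: summable_real_powr_iff\<close>)
  have small: "norm (f n) \<le> 1 / real n" if "n > 0" for n
  proof -
    have "real n powr - s \<le> real n powr - 1" using that s by (intro powr_mono) auto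
    thus ?thesis using nf[of n] that by (simp add: powr_neg_one)
  qed
  have "Re (f q) = real q powr - s * Re (c q)" for q by (simp add: f_def)
  hence E: "(\<Sum>q. if prime q then Re (f q) else 0) = prime_sum c s" by (simp only: prime_sum_def)
  have L: "suminf f = dirichlet_L c s" by (simp add: f_def dirichlet_L_def)
  show "exp (prime_sum c s - 4) \<le> norm (dirichlet_L c s)" "norm (dirichlet_L c s) \<le> exp (prime_sum c s + 4)"
    using euler_product_bounds[OF f f01 sm small] unfolding E L by simp_all
qed

definition prime_zeta :: "real \<Rightarrow> real" where
  "prime_zeta s = prime_sum (\<lambda>n. if n = 0 then 0 else 1) s"

text \<open>
  The logarithm of the simple pole of zeta, carried over to the sum over primes.
\<close>

lemma prime_zeta_bounds:
  assumes t: "t > 0"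
  shows "1 / t \<le> exp (prime_zeta (1 + t) + 4)" and "exp (prime_zeta (1 + t) - 4) \<le> 1 + 1 / t"
proof -
  let ?c = "\<lambda>n::nat. if n = 0 then 0 else (1::complex)"
  have s: "1 + t > 1" using t by simp
  have c: "(\<lambda>n. (real n powr - (1 + t)) *\<^sub>R ?c n) = (\<lambda>n. complex_of_real (real n powr - (1 + t)))"
    by (intro ext) (simp add: scaleR_conv_of_real)
  have sz: "summable (\<lambda>n. real n powr - (1 + t))" using t by (simp add: summable_real_powr_iff)
  have "dirichlet_L ?c (1 + t) = (\<Sum>n. complex_of_real (real n powr - (1 + t)))"
    unfolding dirichlet_L_def by (rule arg_cong[OF c])
  also have "\<dots> = of_real (\<Sum>n. real n powr - (1 + t))" by (rule suminf_of_real[OF sz, symmetric])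
  finally have L: "dirichlet_L ?c (1 + t) = of_real (\<Sum>n. real n powr - (1 + t))" .
  have pos: "0 \<le> (\<Sum>n. real n powr - (1 + t))" using order_trans[OF _ zeta_bounds(1)[OF t], of 0] t by simp
  have n: "norm (dirichlet_L ?c (1 + t)) = (\<Sum>n. real n powr - (1 + t))"
    unfolding L norm_of_real using pos by (rule abs_of_nonneg)
  have "exp (prime_zeta (1 + t) - 4) \<le> norm (dirichlet_L ?c (1 + t))"
    unfolding prime_zeta_def by (rule dirichlet_L_prime_sum(1)[of ?c]) (use s in auto)
  thus "exp (prime_zeta (1 + t) - 4) \<le> 1 + 1 / t" unfolding n using zeta_bounds(2)[OF t] by linarith
  have "norm (dirichlet_L ?c (1 + t)) \<le> exp (prime_zeta (1 + t) + 4)"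
    unfolding prime_zeta_def by (rule dirichlet_L_prime_sum(2)[of ?c]) (use s in auto)
  thus "1 / t \<le> exp (prime_zeta (1 + t) + 4)" unfolding n using zeta_bounds(1)[OF t] by linarith
qed

lemma exists_small_linear:
  fixes C :: real assumes "C \<ge> 0"
  obtains t where "0 < t" "t \<le> 1" "C * t < 1"
proof (rule that[of "1 / (C + 1)"])
  show "C * (1 / (C + 1)) < 1" using assms by (simp add: pos_divide_less_eq)
qed (use assms in auto)

context prime_characters
begin

abbreviation "P j t \<equiv> prime_sum (chi j) (1 + t)"

lemma L_bounds:
  assumes t: "t > 0"
  shows "exp (P j t - 4) \<le> norm (dirichlet_L (chi j) (1 + t))"
    and "norm (dirichlet_L (chi j) (1 + t)) \<le> exp (P j t + 4)"
  by (rule dirichlet_L_prime_sum[OF chi_mult chi_1 chi_0 norm_chi_le], use t in simp)+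

text \<open>
  The principal character only omits the prime \<open>p\<close> from the sum over all primes.
\<close>

lemma P_0_bounds:
  assumes t: "t > 0"
  shows "P 0 t \<le> prime_zeta (1 + t)" and "prime_zeta (1 + t) \<le> P 0 t + 1"
proof -
  let ?u = "\<lambda>q. if prime q then real q powr - (1 + t) * Re (if q = 0 then 0 else 1) else 0"
  let ?v = "\<lambda>q. if prime q then real q powr - (1 + t) * Re (chi 0 q) else 0"
  have su: "summable ?u" by (rule prime_sum_summable) (use t in auto)
  have sv: "summable ?v" by (rule prime_sum_summable[OF norm_chi_le]) (use t in auto)
  have eq: "?u q - ?v q = (if q = p then real p powr - (1 + t) else 0)" for q
  proof (cases "prime q")
    case True
    have "p dvd q \<longleftrightarrow> q = p" using primes_dvd_imp_eq[OF prime_p True] by auto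
    moreover have "q \<noteq> 0" using True by auto
    ultimately show ?thesis using True by (simp add: chi_def)
  next
    case False
    thus ?thesis using prime_p by auto
  qed
  have "(\<lambda>q. ?u q - ?v q) sums (prime_zeta (1 + t) - P 0 t)"
    unfolding prime_zeta_def prime_sum_def by (intro sums_diff summable_sums su sv)
  moreover have "(\<lambda>q. if q = p then real p powr - (1 + t) else 0) sums (real p powr - (1 + t))"
    by (rule sums_single)
  ultimately have d: "prime_zeta (1 + t) - P 0 t = real p powr - (1 + t)"
    unfolding eq by (rule sums_unique2)
  have "real p powr - (1 + t) \<le> 1" using powr_mono[of "- (1 + t)" 0 "real p"] p_gt_1 t by simp
  thus "P 0 t \<le> prime_zeta (1 + t)" "prime_zeta (1 + t) \<le> P 0 t + 1"
    using d powr_ge_zero[of "real p" "- (1 + t)"] by linarith+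
qed

text \<open>
  Orthogonality selects the primes \<open>q\<close> with \<open>a * q \<equiv> 1 (mod p)\<close>. It is used for \<open>a = 1\<close>, where
  only the sign of the result matters, and for \<open>a = p - 1\<close>, the class of -1.
\<close>

lemma sum_prime_sums:
  assumes t: "t > 0"
  shows "(\<Sum>j<p - 1. prime_sum (\<lambda>n. chi j (a * n)) (1 + t)) =
    real (p - 1) * (\<Sum>q. if prime q \<and> (a * q) mod p = 1 then real q powr - (1 + t) else 0)"
proof -
  let ?f = "\<lambda>j q. if prime q then real q powr - (1 + t) * Re (chi j (a * q)) else 0"
  have sm: "summable (?f j)" for j
    by (rule prime_sum_summable[of "\<lambda>n. chi j (a * n)", OF norm_chi_le]) (use t in simp)
  let ?g = "\<lambda>q. if prime q \<and> (a * q) mod p = 1 then real q powr - (1 + t) else 0"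
  have sg: "summable ?g"
    by (rule summable_comparison_test'[where N = 0 and g = "\<lambda>n. real n powr - (1 + t)"])
       (use t in \<open>auto simp: summable_real_powr_iff\<close>)
  have "(\<Sum>j<p - 1. prime_sum (\<lambda>n. chi j (a * n)) (1 + t)) = (\<Sum>q. \<Sum>j<p - 1. ?f j q)"
    unfolding prime_sum_def using sm by (rule suminf_sum[symmetric])
  also have "(\<lambda>q. \<Sum>j<p - 1. ?f j q) = (\<lambda>q. real (p - 1) * ?g q)"
  proof
    fix q
    have "(\<Sum>j<p - 1. Re (chi j (a * q))) = Re (\<Sum>j<p - 1. chi j (a * q))" by (simp only: Re_sum)
    also have "\<dots> = (if (a * q) mod p = 1 then real (p - 1) else 0)"
      unfolding sum_chi_orthogonal by simp
    finally have "(\<Sum>j<p - 1. real q powr - (1 + t) * Re (chi j (a * q))) =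
        real q powr - (1 + t) * (if (a * q) mod p = 1 then real (p - 1) else 0)"
      by (simp only: sum_distrib_left[symmetric])
    thus "(\<Sum>j<p - 1. ?f j q) = real (p - 1) * ?g q" by (cases "prime q") simp_all
  qed
  also have "(\<Sum>q. real (p - 1) * ?g q) = real (p - 1) * suminf ?g" by (rule suminf_mult[OF sg])
  finally show ?thesis .
qed

lemma sum_P_nonneg:
  assumes t: "t > 0"
  shows "0 \<le> (\<Sum>j<p - 1. P j t)"
proof -
  let ?g = "\<lambda>q. if prime q \<and> (1 * q) mod p = 1 then real q powr - (1 + t) else 0"
  have "summable ?g"
    by (rule summable_comparison_test'[where N = 0 and g = "\<lambda>n. real n powr - (1 + t)"])
       (use t in \<open>auto simp: summable_real_powr_iff\<close>)
  hence "0 \<le> suminf ?g" by (rule suminf_nonneg) simp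
  hence "0 \<le> real (p - 1) * suminf ?g" by simp
  also have "\<dots> = (\<Sum>j<p - 1. prime_sum (\<lambda>n. chi j (1 * n)) (1 + t))" by (rule sum_prime_sums[OF t, symmetric])
  also have "\<dots> = (\<Sum>j<p - 1. P j t)" by (simp only: mult_1_left)
  finally show ?thesis .
qed

text \<open>
  These two constants serve all non-principal characters at once, since their partial sums are
  bounded by \<open>p\<close> uniformly.
\<close>

definition "lipschitz_const = real p * (\<Sum>n. 3 * real n powr - (3 / 2))"
definition "exp_bound = exp 4 * (2 * real p)"

lemma lipschitz_const_nonneg: "lipschitz_const \<ge> 0"
  unfolding lipschitz_const_def by (intro mult_nonneg_nonneg suminf_nonneg summable_mult) (auto simp: summable_real_powr_iff)

lemma exp_bound_ge_1: "exp_bound \<ge> 1"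
proof -
  have "1 * 1 \<le> exp 4 * (2 * real p)" using p_gt_0 by (intro mult_mono) auto
  thus ?thesis by (simp add: exp_bound_def)
qed

lemma exp_P_le_bound:
  assumes j: "0 < j" "j < p - 1" and t: "t > 0"
  shows "exp (P j t) \<le> exp_bound"
proof -
  have "exp (P j t - 4) \<le> 2 * real p"
    using L_bounds(1)[OF t, of j] dirichlet_L_bounded(2)[OF sum_chi_bounded[OF j], of "1 + t"] t by simp
  hence "exp 4 * exp (P j t - 4) \<le> exp 4 * (2 * real p)" by (rule mult_left_mono) simp
  thus ?thesis by (simp add: exp_bound_def exp_add[symmetric])
qed

lemma L_lipschitz:
  assumes j: "0 < j" "j < p - 1" and t: "t > 0"
  shows "norm (dirichlet_L (chi j) 1 - dirichlet_L (chi j) (1 + t)) \<le> lipschitz_const * t"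
  unfolding lipschitz_const_def using t by (intro dirichlet_L_lipschitz[OF sum_chi_bounded[OF j]]) simp

lemma L1_conjugate:
  assumes j: "0 < j" "j < p - 1"
  shows "dirichlet_L (chi (p - 1 - j)) 1 = cnj (dirichlet_L (chi j) 1)"
proof -
  have "cnj (\<Sum>n. (real n powr - 1) *\<^sub>R chi j n) = (\<Sum>n. cnj ((real n powr - 1) *\<^sub>R chi j n))"
    by (rule bounded_linear.suminf[OF bounded_linear_cnj dirichlet_L_bounded(1)[OF sum_chi_bounded[OF j] zero_less_one]])
  also have "\<dots> = (\<Sum>n. (real n powr - 1) *\<^sub>R chi (p - 1 - j) n)"
    using j(2) by (simp only: chi_conjugate complex_cnj_scaleR)
  finally show ?thesis unfolding dirichlet_L_def by (rule sym)
qed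

lemma L1_nonzero_real:
  assumes j: "0 < j" "2 * j = p - 1"
  shows "dirichlet_L (chi j) 1 \<noteq> 0"
proof -
  have j': "j < p - 1" using j by linarith
  define c where "c = (\<lambda>n. Re (chi j n))"
  have chi_c: "chi j n = of_real (c n)" for n
    using chi_real_values[OF j(2), of n] by (auto simp: c_def)
  have val: "c n \<in> {-1, 0, 1}" for n
    using chi_real_values[OF j(2), of n] by (auto simp: c_def)
  have mult: "c (m * n) = c m * c n" for m n
    using chi_mult[of j m n] unfolding chi_c by (simp only: of_real_mult[symmetric] of_real_eq_iff)
  have c1: "c 1 = 1" using chi_1[of j] by (simp only: c_def one_complex.sel)
  have S: "norm (\<Sum>k<n. c k) \<le> real p" for n
  proof -
    have "(\<Sum>k<n. c k) = Re (\<Sum>k<n. chi j k)" by (simp only: c_def Re_sum)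
    thus ?thesis using abs_Re_le_cmod[of "\<Sum>k<n. chi j k"] sum_chi_bounded[OF j(1) j', of n] by simp
  qed
  have "dirichlet_L c 1 \<noteq> 0" by (rule real_character_L1_nonzero[OF mult c1 val S])
  moreover have "dirichlet_L (chi j) 1 = of_real (dirichlet_L c 1)"
    unfolding dirichlet_L_def chi_c
    using suminf_of_real[OF dirichlet_L_bounded(1)[OF S zero_less_one], where 'a = complex]
    by (simp add: scaleR_conv_of_real)
  ultimately show ?thesis by simp
qed

text \<open>
  The sum over all characters of \<open>P j t\<close> is non-negative, so the product of the \<open>exp (P j t)\<close> is at least
  1. The principal character contributes a factor \<open>O(1/t)\<close>, the others are bounded, and a character
  with a zero at 1 contributes \<open>O(t)\<close>. Two zeros would make the product \<open>O(t)\<close>, which is impossible for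
  small \<open>t\<close>. A zero of a non-real character is accompanied by the zero of its conjugate; the remaining
  case of a real character is Monsky's.
\<close>

lemma L1_nonzero:
  assumes j: "0 < j" "j < p - 1"
  shows "dirichlet_L (chi j) 1 \<noteq> 0"
proof
  assume L0: "dirichlet_L (chi j) 1 = 0"
  define i where "i = p - 1 - j"
  have i: "0 < i" "i < p - 1" using j by (simp_all add: i_def)
  have L0': "dirichlet_L (chi i) 1 = 0" unfolding i_def L1_conjugate[OF j] L0 by simp
  have "i \<noteq> j"
  proof
    assume "i = j"
    hence "2 * j = p - 1" using j unfolding i_def by linarith
    thus False using L1_nonzero_real[OF j(1)] L0 by blast
  qed
  have small: "exp (P k t) \<le> exp 4 * (lipschitz_const * t)" if k: "0 < k" "k < p - 1" "dirichlet_L (chi k) 1 = 0" and t: "t > 0" for k t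
  proof -
    have "exp (P k t - 4) \<le> lipschitz_const * t"
      using L_bounds(1)[OF t, of k] L_lipschitz[OF k(1,2) t] unfolding k(3) by simp
    hence "exp 4 * exp (P k t - 4) \<le> exp 4 * (lipschitz_const * t)" by (rule mult_left_mono) simp
    thus ?thesis by (simp add: exp_add[symmetric])
  qed
  \<comment> \<open>The product of the constants in the bounds for \<open>exp (P k t)\<close>: \<open>exp 8\<close> for the principal character, \<open>exp 4 * lipschitz_const\<close> for each of the two zeros, and at most \<open>p\<close> factors \<open>exp_bound\<close>.\<close>
  define C where "C = exp 8 * (exp 4 * lipschitz_const) * (exp 4 * lipschitz_const) * exp_bound ^ p"
  have C: "C \<ge> 0" using lipschitz_const_nonneg exp_bound_ge_1 by (simp add: C_def)
  have key: "1 \<le> 2 * C * t" if t: "0 < t" "t \<le> 1" for t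
  proof -
    let ?R = "{..<p - 1} - {0, i, j}"
    have "(\<Sum>k<p - 1. P k t) = P 0 t + P i t + P j t + (\<Sum>k\<in>?R. P k t)"
    proof -
      have "{..<p - 1} = {0, i, j} \<union> ?R" using i j p1_gt_0 by auto
      hence "(\<Sum>k<p - 1. P k t) = (\<Sum>k\<in>{0, i, j} \<union> ?R. P k t)" by (simp only:)
      also have "\<dots> = (\<Sum>k\<in>{0, i, j}. P k t) + (\<Sum>k\<in>?R. P k t)" by (rule sum.union_disjoint) auto
      also have "(\<Sum>k\<in>{0, i, j}. P k t) = P 0 t + P i t + P j t" using i j \<open>i \<noteq> j\<close> by simp
      finally show ?thesis .
    qed
    hence "0 \<le> P 0 t + P i t + P j t + (\<Sum>k\<in>?R. P k t)" using sum_P_nonneg[OF t(1)] by simp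
    hence "1 \<le> exp (P 0 t + P i t + P j t + (\<Sum>k\<in>?R. P k t))" by simp
    also have "\<dots> = exp (P 0 t) * exp (P i t) * exp (P j t) * (\<Prod>k\<in>?R. exp (P k t))"
      by (simp add: exp_add exp_sum)
    also have "\<dots> \<le> (exp 8 * (1 + 1 / t)) * (exp 4 * (lipschitz_const * t)) * (exp 4 * (lipschitz_const * t)) * exp_bound ^ p"
    proof (intro mult_mono)
      have "exp (P 0 t) \<le> exp (prime_zeta (1 + t))" using P_0_bounds(1)[OF t(1)] by simp
      also have "\<dots> = exp 4 * exp (prime_zeta (1 + t) - 4)" by (simp add: exp_add[symmetric])
      also have "\<dots> \<le> exp 8 * (1 + 1 / t)"
        using prime_zeta_bounds(2)[OF t(1)] by (intro mult_mono) auto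
      finally show "exp (P 0 t) \<le> exp 8 * (1 + 1 / t)" .
      show "exp (P i t) \<le> exp 4 * (lipschitz_const * t)" by (rule small[OF i L0' t(1)])
      show "exp (P j t) \<le> exp 4 * (lipschitz_const * t)" by (rule small[OF j L0 t(1)])
      have "(\<Prod>k\<in>?R. exp (P k t)) \<le> (\<Prod>k\<in>?R. exp_bound)"
        using t by (intro prod_mono conjI exp_P_le_bound) auto
      also have "\<dots> = exp_bound ^ card ?R" by simp
      also have "\<dots> \<le> exp_bound ^ p"
      proof (rule power_increasing[OF _ exp_bound_ge_1])
        have "card ?R \<le> card {..<p - 1}" by (rule card_mono) auto
        thus "card ?R \<le> p" by simp
      qed
      finally show "(\<Prod>k\<in>?R. exp (P k t)) \<le> exp_bound ^ p" .
    qed (use t lipschitz_const_nonneg in \<open>auto intro!: mult_nonneg_nonneg prod_nonneg\<close>)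
    also have "\<dots> = C * ((1 + 1 / t) * t * t)" by (simp add: C_def mult_ac)
    also have "(1 + 1 / t) * t * t = t * t + t" using t by (simp add: algebra_simps)
    also have "C * (t * t + t) \<le> C * (t + t)"
    proof (rule mult_left_mono[OF _ C])
      have "t * t \<le> 1 * t" using t by (intro mult_right_mono) auto
      thus "t * t + t \<le> t + t" by simp
    qed
    finally show ?thesis by (simp add: algebra_simps)
  qed
  obtain t where "0 < t" "t \<le> 1" "2 * C * t < 1" using exists_small_linear[of "2 * C"] C by auto
  with key[of t] show False by linarith
qed

lemma P_bounded_near_0:
  assumes j: "0 < j" "j < p - 1"
  shows "\<exists>B. \<forall>\<^sub>F t in at_right 0. \<bar>P j t\<bar> \<le> B"
proof -
  define l where "l = norm (dirichlet_L (chi j) 1)"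
  have l: "l > 0" using L1_nonzero[OF j] by (simp add: l_def)
  have exp_bound: "exp_bound > 0" using exp_bound_ge_1 by linarith
  define \<delta> where "\<delta> = l / 2 / (lipschitz_const + 1)"
  have \<delta>: "\<delta> > 0" using l lipschitz_const_nonneg by (simp add: \<delta>_def)
  have "\<bar>P j t\<bar> \<le> \<bar>ln exp_bound\<bar> + \<bar>ln (l / 2)\<bar> + 4" if t: "0 < t" "t < \<delta>" for t
  proof -
    have "P j t \<le> ln exp_bound" using exp_P_le_bound[OF j t(1)] exp_bound by (simp add: ln_ge_iff)
    moreover have "ln (l / 2) \<le> P j t + 4"
    proof -
      have "lipschitz_const * t \<le> (lipschitz_const + 1) * \<delta>" using t lipschitz_const_nonneg by (intro mult_mono) auto
      also have "\<dots> = l / 2"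
      proof -
        have "lipschitz_const + 1 \<noteq> 0" using lipschitz_const_nonneg by linarith
        thus ?thesis unfolding \<delta>_def times_divide_eq_right[of "lipschitz_const + 1" "l / 2" "lipschitz_const + 1"]
          by (rule nonzero_mult_div_cancel_left)
      qed
      finally have "lipschitz_const * t \<le> l / 2" .
      moreover have "l \<le> norm (dirichlet_L (chi j) 1 - dirichlet_L (chi j) (1 + t)) + norm (dirichlet_L (chi j) (1 + t))"
        unfolding l_def using norm_triangle_ineq[of "dirichlet_L (chi j) 1 - dirichlet_L (chi j) (1 + t)" "dirichlet_L (chi j) (1 + t)"] by simp
      ultimately have "l / 2 \<le> exp (P j t + 4)"
        using L_lipschitz[OF j t(1)] L_bounds(2)[OF t(1), of j] by linarith
      hence "ln (l / 2) \<le> ln (exp (P j t + 4))" using l by (intro ln_mono) auto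
      thus ?thesis by (simp only: ln_exp)
    qed
    ultimately show ?thesis by linarith
  qed
  thus ?thesis
    using \<delta> by (intro exI[of _ "\<bar>ln exp_bound\<bar> + \<bar>ln (l / 2)\<bar> + 4"]) (auto simp: eventually_at_right_field)
qed

lemma chi_minus_one:
  "chi j (p - 1) \<in> {-1, 1}"
proof -
  have "int ((p - 1) * (p - 1)) = int p * (int p - 2) + 1"
  proof -
    have "int p = int (p - 1) + 1" using p_gt_0 by linarith
    thus ?thesis unfolding of_nat_mult by (simp only: algebra_simps)
  qed
  hence "int ((p - 1) * (p - 1)) mod int p = 1 mod int p" by simp
  hence "((p - 1) * (p - 1)) mod p = 1 mod p" by (metis of_nat_mod of_nat_1 of_nat_eq_iff)
  hence "chi j ((p - 1) * (p - 1)) = chi j 1" by (rule chi_cong)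
  hence "(chi j (p - 1))\<^sup>2 = 1" by (simp only: chi_mult chi_1 power2_eq_square)
  thus ?thesis by (auto simp: power2_eq_1_iff)
qed

lemma minus_one_class_iff: "((p - 1) * q) mod p = 1 \<longleftrightarrow> p dvd q + 1"
proof -
  have "((p - 1) * q) mod p = 1 \<longleftrightarrow> [(p - 1) * q = 1] (mod p)"
    using p_gt_1 by (simp add: cong_def)
  also have "\<dots> \<longleftrightarrow> [(p - 1) * q + (q + 1) = 1 + (q + 1)] (mod p)" by (rule cong_add_rcancel_nat[symmetric])
  also have "(p - 1) * q + (q + 1) = 1 + p * q" using p_gt_0 by (cases p) auto
  also have "[1 + p * q = 1 + (q + 1)] (mod p) \<longleftrightarrow> [p * q = q + 1] (mod p)" by (rule cong_add_lcancel_nat)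
  also have "\<dots> \<longleftrightarrow> p dvd q + 1" unfolding cong_def dvd_eq_mod_eq_0 by auto
  finally show ?thesis .
qed

text \<open>
  If the sum converged, the primes in the class of -1 would contribute a bounded amount to
  \<open>\<Sum>j. \<chi>\<^sub>j(-1) P j t\<close>. All terms with \<open>j \<noteq> 0\<close> are bounded near \<open>t = 0\<close>, so \<open>P 0 t\<close> would be bounded too,
  against the pole of zeta.
\<close>

theorem sum_inverse_primes_minus_one:
  "\<not> summable (\<lambda>q. if prime q \<and> p dvd q + 1 then 1 / real q else 0)"
proof
  let ?h = "\<lambda>q. if prime q \<and> p dvd q + 1 then 1 / real q else 0"
  assume sh: "summable ?h"
  have "\<forall>j\<in>{0<..<p - 1}. \<exists>B. \<forall>\<^sub>F t in at_right 0. \<bar>P j t\<bar> \<le> B"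
    using P_bounded_near_0 by simp
  then obtain B where B: "\<forall>j\<in>{0<..<p - 1}. \<forall>\<^sub>F t in at_right 0. \<bar>P j t\<bar> \<le> B j"
    by (rule bchoice[THEN exE])
  hence ev: "\<forall>\<^sub>F t in at_right 0. \<forall>j\<in>{0<..<p - 1}. \<bar>P j t\<bar> \<le> B j"
    by (intro eventually_ball_finite) auto
  define M where "M = real (p - 1) * suminf ?h + (\<Sum>j\<in>{0<..<p - 1}. B j) + 5"
  have bound: "1 / t \<le> exp M" if t: "t > 0" and Pt: "\<forall>j\<in>{0<..<p - 1}. \<bar>P j t\<bar> \<le> B j" for t
  proof -
    let ?g = "\<lambda>q. if prime q \<and> ((p - 1) * q) mod p = 1 then real q powr - (1 + t) else 0"
    have gh: "?g q \<le> ?h q" for q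
    proof (cases "prime q \<and> p dvd q + 1")
      case True
      hence "q > 0" using prime_gt_0_nat by blast
      hence "real q powr - (1 + t) \<le> real q powr - 1" using t by (intro powr_mono) auto
      thus ?thesis using True minus_one_class_iff[of q] \<open>q > 0\<close> by (simp add: powr_neg_one)
    next
      case False
      thus ?thesis unfolding minus_one_class_iff by auto
    qed
    have sg: "summable ?g"
      by (rule summable_comparison_test'[OF sh, of 0]) (use gh in auto)
    \<comment> \<open>These values are signs, so they can be moved through the real part in the sum over primes.\<close>
    define e where "e = (\<lambda>j. Re (chi j (p - 1)))"
    have e: "e j \<in> {-1, 1}" and ce: "chi j (p - 1) = of_real (e j)" for j
      using chi_minus_one[of j] by (auto simp: e_def)
    have "prime_sum (\<lambda>n. chi j ((p - 1) * n)) (1 + t) = e j * P j t" for j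
    proof -
      have "prime_sum (\<lambda>n. chi j ((p - 1) * n)) (1 + t) =
          (\<Sum>q. e j * (if prime q then real q powr - (1 + t) * Re (chi j q) else 0))"
        unfolding prime_sum_def chi_mult ce by (intro suminf_cong) simp
      also have "\<dots> = e j * P j t"
        unfolding prime_sum_def
        by (rule suminf_mult[OF prime_sum_summable[OF norm_chi_le]]) (use t in simp)
      finally show ?thesis .
    qed
    hence "(\<Sum>j<p - 1. e j * P j t) = real (p - 1) * suminf ?g"
      using sum_prime_sums[OF t, of "p - 1"] by (simp only:)
    also have "\<dots> \<le> real (p - 1) * suminf ?h"
      by (intro mult_left_mono suminf_le gh sg sh) simp
    finally have "(\<Sum>j<p - 1. e j * P j t) \<le> real (p - 1) * suminf ?h" .
    moreover have "(\<Sum>j<p - 1. e j * P j t) = e 0 * P 0 t + (\<Sum>j\<in>{0<..<p - 1}. e j * P j t)"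
    proof -
      have "{..<p - 1} = insert 0 {0<..<p - 1}" using p1_gt_0 by auto
      thus ?thesis by simp
    qed
    moreover have "e 0 = 1"
    proof -
      have "\<not> p dvd p - 1" using p1_gt_0 by (intro nat_dvd_not_less) auto
      thus ?thesis by (simp add: e_def chi_def)
    qed
    moreover have "(\<Sum>j\<in>{0<..<p - 1}. - B j) \<le> (\<Sum>j\<in>{0<..<p - 1}. e j * P j t)"
    proof (rule sum_mono)
      fix j assume "j \<in> {0<..<p - 1}"
      hence "\<bar>P j t\<bar> \<le> B j" using Pt by blast
      thus "- B j \<le> e j * P j t" using e[of j] by auto
    qed
    ultimately have "P 0 t \<le> real (p - 1) * suminf ?h + (\<Sum>j\<in>{0<..<p - 1}. B j)"
      by (simp add: sum_negf)
    hence "prime_zeta (1 + t) + 4 \<le> M" using P_0_bounds(2)[OF t] unfolding M_def by linarith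
    hence "exp (prime_zeta (1 + t) + 4) \<le> exp M" by simp
    with prime_zeta_bounds(1)[OF t] show ?thesis by linarith
  qed
  have "\<forall>\<^sub>F t in at_right 0. exp M < 1 / t"
    using filterlim_inverse_at_top_right[unfolded filterlim_at_top_dense, rule_format, of "exp M"]
    by (simp add: inverse_eq_divide)
  moreover have "\<forall>\<^sub>F t in at_right 0. (t::real) > 0" by (rule eventually_at_right_less)
  ultimately have "\<forall>\<^sub>F t in at_right (0::real). False"
    using ev
  proof eventually_elim
    case (elim t)
    thus False using bound[of t] by simp
  qed
  thus False by simp
qed

end

lemma sum_inverse_primes_minus_one_mod:
  assumes "prime p"
  shows "\<not> summable (\<lambda>q. if prime q \<and> p dvd q + 1 then 1 / real q else 0)"
proof -
  obtain g where "residue_primroot p g"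
    using prime_primitive_root_exists[of p] assms prime_gt_1_nat[of p] by auto
  then interpret prime_characters p g using assms by unfold_locales
  show ?thesis by (rule sum_inverse_primes_minus_one)
qed

section \<open>Sets of density zero and the distribution of the ratio\<close>

text \<open>
  The constant \<open>C\<close> depends on \<open>\<eta>\<close> but not on \<open>n\<close>; it absorbs all bounded errors, so that no
  statement about sufficiently large \<open>n\<close> has to be carried through the proof.
\<close>

definition density_zero :: "nat set \<Rightarrow> bool" where
  "density_zero A \<longleftrightarrow> (\<forall>\<eta>>0. \<exists>C. \<forall>n. real (card (A \<inter> {1..n})) \<le> \<eta> * real n + C)"

lemma density_zeroD:
  assumes "density_zero A" "\<eta> > 0"
  obtains C where "\<And>n. real (card (A \<inter> {1..n})) \<le> \<eta> * real n + C"
  using assms unfolding density_zero_def by blast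

lemma density_zero_Un:
  assumes "density_zero A" "density_zero B"
  shows "density_zero (A \<union> B)"
  unfolding density_zero_def
proof (intro allI impI)
  fix \<eta> :: real assume "\<eta> > 0"
  hence \<eta>: "\<eta> / 2 > 0" by simp
  obtain C where C: "\<And>n. real (card (A \<inter> {1..n})) \<le> \<eta> / 2 * real n + C"
    by (rule density_zeroD[OF assms(1) \<eta>]) (rule that)
  obtain D where D: "\<And>n. real (card (B \<inter> {1..n})) \<le> \<eta> / 2 * real n + D"
    by (rule density_zeroD[OF assms(2) \<eta>]) (rule that)
  have "real (card ((A \<union> B) \<inter> {1..n})) \<le> \<eta> * real n + (C + D)" for n
  proof -
    have "card ((A \<union> B) \<inter> {1..n}) \<le> card (A \<inter> {1..n}) + card (B \<inter> {1..n})"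
      by (metis Int_Un_distrib2 card_Un_le)
    hence "real (card ((A \<union> B) \<inter> {1..n})) \<le> real (card (A \<inter> {1..n})) + real (card (B \<inter> {1..n}))"
      by (simp only: of_nat_add [symmetric] of_nat_le_iff)
    with C[of n] D[of n] show ?thesis by (simp add: field_simps)
  qed
  thus "\<exists>C. \<forall>n. real (card ((A \<union> B) \<inter> {1..n})) \<le> \<eta> * real n + C"
    by (intro exI[of _ "C + D"] allI)
qed

lemma density_zero_empty: "density_zero {}"
  unfolding density_zero_def by (auto intro!: exI[of _ 0])

lemma density_zero_UN:
  assumes "finite I" "\<And>i. i \<in> I \<Longrightarrow> density_zero (A i)"
  shows "density_zero (\<Union>i\<in>I. A i)"
  using assms by (induction rule: finite_induct) (auto intro: density_zero_Un density_zero_empty)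

text \<open>
  Each block of \<open>D\<close> consecutive integers contains \<open>totient D\<close> integers prime to \<open>D\<close>, and \<open>{1..n}\<close> is
  covered by \<open>n div D + 1\<close> blocks.
\<close>

lemma card_coprime_le:
  fixes D n :: nat assumes "D > 0"
  shows "real (card {a\<in>{1..n}. coprime a D}) \<le> real n * (real (totient D) / real D) + real D"
proof -
  let ?B = "\<lambda>i. (\<lambda>a. i * D + a) ` totatives D"
  have "{a\<in>{1..n}. coprime a D} \<subseteq> (\<Union>i\<in>{..n div D}. ?B i)"
  proof
    fix a assume a: "a \<in> {a\<in>{1..n}. coprime a D}"
    define i where "i = (a - 1) div D"
    define r where "r = (a - 1) mod D + 1"
    have "(a - 1) div D * D + (a - 1) mod D = a - 1" by (rule div_mult_mod_eq)
    moreover have "a \<ge> 1" using a by simp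
    ultimately have eq: "a = i * D + r" unfolding i_def r_def by linarith
    have "(a - 1) mod D < D" using assms by simp
    hence "r \<le> D" unfolding r_def by linarith
    moreover have "coprime r D"
    proof -
      have "gcd D a = gcd D r" using gcd_add_mult[of D i r] by (simp only: eq)
      moreover have "gcd D a = 1" using a by (simp add: coprime_commute)
      ultimately have "gcd D r = 1" by (rule trans[OF sym])
      hence "coprime D r" by (rule coprime_iff_gcd_eq_1[THEN iffD2])
      thus ?thesis by (rule coprime_commute[THEN iffD1])
    qed
    moreover have "r > 0" by (simp add: r_def)
    ultimately have r: "r \<in> totatives D" by (simp add: totatives_def)
    have "a \<le> n" using a by simp
    hence "a - 1 \<le> n" by linarith
    hence "i \<le> n div D" unfolding i_def by (rule div_le_mono)
    thus "a \<in> (\<Union>i\<in>{..n div D}. ?B i)"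
      by (intro UN_I[of i] image_eqI[where f = "\<lambda>a. i * D + a" and x = r] eq r) simp
  qed
  hence "card {a\<in>{1..n}. coprime a D} \<le> card (\<Union>i\<in>{..n div D}. ?B i)"
    by (intro card_mono) auto
  also have "\<dots> \<le> (\<Sum>i\<in>{..n div D}. card (?B i))" by (intro card_UN_le) auto
  also have "\<dots> \<le> (\<Sum>i\<in>{..n div D}. totient D)"
    by (intro sum_mono) (auto simp: totient_def intro: card_image_le)
  also have "\<dots> = (n div D + 1) * totient D" by simp
  finally have "real (card {a\<in>{1..n}. coprime a D}) \<le> real ((n div D + 1) * totient D)"
    by (simp only: of_nat_le_iff)
  also have "\<dots> = real (n div D) * totient D + totient D" by (simp add: algebra_simps)
  also have "\<dots> \<le> real n / real D * totient D + real D"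
    using of_nat_div_le_of_nat[of n D] totient_le[of D] by (intro add_mono mult_right_mono) auto
  finally show ?thesis by simp
qed

text \<open>
  Take enough primes of \<open>Q\<close> that the sum of their reciprocals exceeds \<open>ln (1 / \<eta>)\<close>. The density of the
  integers prime to all of them is the product of the \<open>1 - 1/q\<close>, hence at most \<open>\<eta>\<close>. That a finite part
  of \<open>Q\<close> suffices is used again for \<open>psi_ratio_continuous_distribution\<close>.
\<close>

lemma card_sifted_le:
  fixes Q :: "nat set" and \<eta> :: real
  assumes Q: "\<And>q. q \<in> Q \<Longrightarrow> prime q"
    and div: "\<not> summable (\<lambda>q. if q \<in> Q then 1 / real q else 0)"
    and \<eta>: "\<eta> > 0"
  shows "\<exists>N C. \<forall>n. real (card ({a. \<forall>q\<in>Q \<inter> {..<N}. \<not> q dvd a} \<inter> {1..n})) \<le> \<eta> * real n + C"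
proof -
  have "\<exists>N. (\<Sum>q<N. if q \<in> Q then 1 / real q else 0) > ln (1 / \<eta>)"
  proof (rule ccontr)
    assume "\<not> ?thesis"
    hence "summable (\<lambda>q. if q \<in> Q then 1 / real q else 0)"
      by (intro summableI_nonneg_bounded[of _ "ln (1 / \<eta>)"]) (auto simp: not_less)
    with div show False by simp
  qed
  then obtain N where N: "(\<Sum>q<N. if q \<in> Q then 1 / real q else 0) > ln (1 / \<eta>)" ..
  define P where "P = Q \<inter> {..<N}"
  have fin: "finite P" by (simp add: P_def)
  have Pprime: "\<And>q. q \<in> P \<Longrightarrow> prime q" using Q by (auto simp: P_def)
  have S: "(\<Sum>q\<in>P. 1 / real q) > ln (1 / \<eta>)"
    using N by (simp add: P_def Int_commute[of Q] sum.inter_restrict)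
  define D where "D = \<Prod>P"
  have D0: "D > 0" using Pprime by (auto simp: D_def prime_gt_0_nat intro!: prod_pos)
  have pf: "prime_factors D = P"
  proof (intro equalityI subsetI)
    fix x assume "x \<in> prime_factors D"
    hence x: "prime x" "x dvd D" by (simp_all add: in_prime_factors_iff)
    then obtain y where "y \<in> P" "x dvd y"
      unfolding D_def using prime_dvd_prod_iff[OF fin x(1), of "\<lambda>p. p"] by blast
    thus "x \<in> P" using primes_dvd_imp_eq[OF x(1) Pprime] by blast
  next
    fix x assume "x \<in> P"
    thus "x \<in> prime_factors D"
      using Pprime[of x] D0 dvd_prodI[OF fin, of x "\<lambda>p. p"] by (simp add: in_prime_factors_iff D_def)
  qed
  have "real (totient D) / real D = (\<Prod>p\<in>P. 1 - 1 / real p)"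
    unfolding totient_formula2[of D] pf using D0 by simp
  also have "\<dots> \<le> (\<Prod>p\<in>P. exp (- (1 / real p)))"
  proof (intro prod_mono conjI)
    fix p assume "p \<in> P"
    hence "p > 0" using Pprime prime_gt_0_nat by blast
    hence "real p \<ge> 1" by simp
    thus "0 \<le> 1 - 1 / real p" by simp
    show "1 - 1 / real p \<le> exp (- (1 / real p))"
      using exp_ge_add_one_self[of "- (1 / real p)"] by simp
  qed
  also have "\<dots> = exp (- (\<Sum>p\<in>P. 1 / real p))"
    by (simp only: exp_sum[OF fin, symmetric] sum_negf)
  also have "\<dots> \<le> exp (- ln (1 / \<eta>))" using S by simp
  also have "\<dots> = \<eta>" using \<eta> by (simp add: ln_div)
  finally have le: "real (totient D) / real D \<le> \<eta>" .
  have "real (card ({a. \<forall>q\<in>P. \<not> q dvd a} \<inter> {1..n})) \<le> \<eta> * real n + real D" for n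
  proof -
    have "{a. \<forall>q\<in>P. \<not> q dvd a} \<inter> {1..n} \<subseteq> {a\<in>{1..n}. coprime a D}"
    proof
      fix a assume a: "a \<in> {a. \<forall>q\<in>P. \<not> q dvd a} \<inter> {1..n}"
      have "coprime a q" if "q \<in> P" for q
        using prime_imp_coprime[OF Pprime[OF that], of a] that a by (simp add: coprime_commute)
      hence "coprime a D" unfolding D_def by (rule prod_coprime_right)
      thus "a \<in> {a\<in>{1..n}. coprime a D}" using a by simp
    qed
    hence "card ({a. \<forall>q\<in>P. \<not> q dvd a} \<inter> {1..n}) \<le> card {a\<in>{1..n}. coprime a D}"
      by (intro card_mono) auto
    hence "real (card ({a. \<forall>q\<in>P. \<not> q dvd a} \<inter> {1..n})) \<le> real n * (real (totient D) / real D) + real D"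
      using card_coprime_le[OF D0, of n] by linarith
    also have "\<dots> \<le> real n * \<eta> + real D" using le by (intro add_mono mult_left_mono) auto
    finally show ?thesis by (simp add: mult.commute)
  qed
  thus ?thesis unfolding P_def by (intro exI[of _ N] exI[of _ "real D"] allI)
qed

lemma density_zero_sifted:
  fixes Q :: "nat set"
  assumes Q: "\<And>q. q \<in> Q \<Longrightarrow> prime q"
    and div: "\<not> summable (\<lambda>q. if q \<in> Q then 1 / real q else 0)"
  shows "density_zero {a. \<forall>q\<in>Q. \<not> q dvd a}"
  unfolding density_zero_def
proof (intro allI impI)
  fix \<eta> :: real assume "\<eta> > 0"
  with Q div have "\<exists>N C. \<forall>n. real (card ({a. \<forall>q\<in>Q \<inter> {..<N}. \<not> q dvd a} \<inter> {1..n})) \<le> \<eta> * real n + C"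
    by (rule card_sifted_le)
  then obtain N C where
    C: "\<forall>n. real (card ({a. \<forall>q\<in>Q \<inter> {..<N}. \<not> q dvd a} \<inter> {1..n})) \<le> \<eta> * real n + C"
    by (elim exE) (rule that)
  have "real (card ({a. \<forall>q\<in>Q. \<not> q dvd a} \<inter> {1..n})) \<le> \<eta> * real n + C" for n
  proof -
    have "card ({a. \<forall>q\<in>Q. \<not> q dvd a} \<inter> {1..n}) \<le> card ({a. \<forall>q\<in>Q \<inter> {..<N}. \<not> q dvd a} \<inter> {1..n})"
      by (intro card_mono) auto
    with C[rule_format, of n] show ?thesis by linarith
  qed
  thus "\<exists>C. \<forall>n. real (card ({a. \<forall>q\<in>Q. \<not> q dvd a} \<inter> {1..n})) \<le> \<eta> * real n + C"
    by (intro exI[of _ C] allI)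
qed

text \<open>
  Markov's inequality; on average over \<open>a\<close>, a prime \<open>p\<close> contributes \<open>1 / p\<^sup>2\<close>.
\<close>

lemma card_large_prime_tail_le:
  fixes y n :: nat and \<delta> :: real
  assumes "y > 0" "\<delta> > 0"
  shows "real (card {a\<in>{1..n}. \<delta> \<le> (\<Sum>p | p \<in> prime_factors a \<and> y < p. 1 / real p)}) \<le> real n / (real y * \<delta>)"
proof -
  let ?A = "{a\<in>{1..n}. \<delta> \<le> (\<Sum>p | p \<in> prime_factors a \<and> y < p. 1 / real p)}"
  have "\<delta> * real (card ?A) = (\<Sum>a\<in>?A. \<delta>)" by simp
  also have "\<dots> \<le> (\<Sum>a\<in>?A. \<Sum>p | p \<in> prime_factors a \<and> y < p. 1 / real p)"
    by (intro sum_mono) auto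
  also have "\<dots> \<le> (\<Sum>a\<in>{1..n}. \<Sum>p | p \<in> prime_factors a \<and> y < p. 1 / real p)"
    by (intro sum_mono2) (auto intro: sum_nonneg)
  also have "\<dots> \<le> (\<Sum>a\<in>{1..n}. \<Sum>p | p \<in> {y<..n} \<and> p dvd a. 1 / real p)"
    by (intro sum_mono sum_mono2) (auto simp: prime_factors_dvd dest: dvd_imp_le)
  also have "\<dots> = (\<Sum>p\<in>{y<..n}. \<Sum>a | a \<in> {1..n} \<and> p dvd a. 1 / real p)"
    by (rule sum.swap_restrict) auto
  also have "\<dots> = (\<Sum>p\<in>{y<..n}. real (card {a\<in>{1..n}. p dvd a}) / real p)"
    by simp
  also have "\<dots> \<le> (\<Sum>p\<in>{y<..n}. (real n / real p) / real p)"
    by (intro sum_mono divide_right_mono card_multiples_le) auto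
  also have "\<dots> = real n * (\<Sum>p\<in>{y<..n}. 1 / real p ^ 2)"
    by (simp add: sum_distrib_left power2_eq_square)
  also have "\<dots> \<le> real n * (1 / real y)"
    by (intro mult_left_mono sum_inverse_squares_le assms) auto
  finally show ?thesis using assms by (simp add: field_simps)
qed

lemma card_large_square_divisor_le:
  fixes z n :: nat
  assumes "z > 0"
  shows "real (card {a\<in>{1..n}. \<exists>q>z. q\<^sup>2 dvd a}) \<le> real n / real z"
proof -
  have "{a\<in>{1..n}. \<exists>q>z. q\<^sup>2 dvd a} \<subseteq> (\<Union>q\<in>{z<..n}. {a\<in>{1..n}. q\<^sup>2 dvd a})"
  proof
    fix a assume a: "a \<in> {a\<in>{1..n}. \<exists>q>z. q\<^sup>2 dvd a}"
    then obtain q where q: "q > z" "q\<^sup>2 dvd a" by auto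
    have "q dvd a" using q(2) by (metis dvd_trans dvd_triv_left power2_eq_square)
    hence "q \<le> n" using a by (auto dest: dvd_imp_le)
    thus "a \<in> (\<Union>q\<in>{z<..n}. {a\<in>{1..n}. q\<^sup>2 dvd a})" using a q by auto
  qed
  hence "card {a\<in>{1..n}. \<exists>q>z. q\<^sup>2 dvd a} \<le> card (\<Union>q\<in>{z<..n}. {a\<in>{1..n}. q\<^sup>2 dvd a})"
    by (intro card_mono) auto
  also have "\<dots> \<le> (\<Sum>q\<in>{z<..n}. card {a\<in>{1..n}. q\<^sup>2 dvd a})" by (intro card_UN_le) auto
  finally have "real (card {a\<in>{1..n}. \<exists>q>z. q\<^sup>2 dvd a}) \<le> (\<Sum>q\<in>{z<..n}. real (card {a\<in>{1..n}. q\<^sup>2 dvd a}))"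
    by (simp only: of_nat_sum [symmetric] of_nat_le_iff)
  also have "\<dots> \<le> (\<Sum>q\<in>{z<..n}. real n / real (q\<^sup>2))"
    by (intro sum_mono card_multiples_le) auto
  also have "\<dots> = real n * (\<Sum>q\<in>{z<..n}. 1 / real q ^ 2)"
    by (simp add: sum_distrib_left)
  also have "\<dots> \<le> real n * (1 / real z)"
    by (intro mult_left_mono sum_inverse_squares_le assms) auto
  finally show ?thesis by simp
qed

definition psi_ratio :: "nat \<Rightarrow> real" where
  "psi_ratio n = (\<Prod>p\<in>prime_factors n. 1 + 1 / real p)"

lemma psi_ratio_prime_times:
  assumes "prime q" "\<not> q dvd m" "m > 0"
  shows "psi_ratio (m * q) = psi_ratio m * (1 + 1 / real q)"
proof -
  have "prime_factors (m * q) = insert q (prime_factors m)"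
    using assms by (simp add: prime_factors_product prime_prime_factors)
  moreover have "q \<notin> prime_factors m" using assms by (simp add: prime_factors_dvd)
  ultimately show ?thesis by (simp add: psi_ratio_def)
qed

lemma psi_ratio_pos: "psi_ratio n > 0"
  unfolding psi_ratio_def by (intro prod_pos) (auto simp: add_pos_nonneg)

text \<open>
  The quotient of the two factors \<open>1 + 1/q\<close> and \<open>1 + 1/q'\<close> is \<open>1 + (q' - q) / (q (q' + 1))\<close>.
\<close>

lemma prime_ratio_gap:
  fixes q q' w :: nat
  assumes "0 < q" "q < q'" "q' \<le> w"
  shows "(1 + 1 / real q') * (1 + 1 / (real w * (real w + 1))) \<le> 1 + 1 / real q"
proof -
  have 1: "real q + 1 \<le> real q'" "real q' \<le> real w" "real q > 0" using assms by linarith+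
  have "(1 + 1 / real q) / (1 + 1 / real q') = 1 + (real q' - real q) / (real q * (real q' + 1))"
  proof -
    have q: "real q > 0" "real q' > 0" using 1 by linarith+
    hence "(1 + 1 / real q) / (1 + 1 / real q') = ((real q + 1) * real q') / (real q * (real q' + 1))"
      by (simp add: divide_simps)
    also have "(real q + 1) * real q' = real q * (real q' + 1) + (real q' - real q)"
      by (simp add: algebra_simps)
    also have "(real q * (real q' + 1) + (real q' - real q)) / (real q * (real q' + 1)) =
        1 + (real q' - real q) / (real q * (real q' + 1))"
      using q by (simp add: add_divide_distrib)
    finally show ?thesis .
  qed
  moreover have "1 / (real w * (real w + 1)) \<le> (real q' - real q) / (real q * (real q' + 1))"
    using 1 by (intro frac_le mult_mono) auto
  ultimately have "1 + 1 / (real w * (real w + 1)) \<le> (1 + 1 / real q) / (1 + 1 / real q')" by simp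
  moreover have "1 + 1 / real q' > 0" using 1 by (simp add: add_pos_nonneg)
  ultimately show ?thesis by (simp add: pos_le_divide_eq mult.commute)
qed

text \<open>
  Choose a large \<open>z\<close> and then \<open>w\<close> such that most integers have a prime factor \<open>q\<close> in \<open>(z, w)\<close>; for most of
  these, \<open>q\<^sup>2\<close> does not divide \<open>a\<close>. For the remaining \<open>a\<close> the cofactor \<open>a / q\<close> determines \<open>a\<close>: two choices of \<open>q\<close>
  with the same cofactor would give ratios that differ by a factor of at least \<open>1 + \<delta>\<close> by
  \<open>prime_ratio_gap\<close>, too much for both to lie in the given interval. So there are at most \<open>n / z\<close> such \<open>a\<close>.
\<close>

lemma psi_ratio_continuous_distribution:
  fixes t \<eta> :: real
  assumes div: "\<not> summable (\<lambda>q. if prime q then 1 / real q else 0)"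
    and t: "t > 0" and \<eta>: "\<eta> > 0"
  shows "\<exists>\<delta>>0. \<exists>C. \<forall>n. real (card ({a. t < psi_ratio a \<and> psi_ratio a < t * (1 + \<delta>)} \<inter> {1..n})) \<le> \<eta> * real n + C"
proof -
  obtain z :: nat where z: "z > 0" "1 / real z < \<eta> / 4"
  proof -
    obtain m where "inverse (real (Suc m)) < \<eta> / 4" using reals_Archimedean[of "\<eta> / 4"] \<eta> by auto
    thus ?thesis by (intro that[of "Suc m"]) (auto simp: inverse_eq_divide)
  qed
  let ?Q = "{q. prime q \<and> q > z}"
  have "\<not> summable (\<lambda>q. if q \<in> ?Q then 1 / real q else 0)"
  proof
    assume "summable (\<lambda>q. if q \<in> ?Q then 1 / real q else 0)"
    hence "summable (\<lambda>q. if prime q then 1 / real q else 0)"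
      by (rule summable_cong[THEN iffD1, rotated])
         (auto intro!: eventually_mono[OF eventually_gt_at_top[of z]])
    with div show False by simp
  qed
  hence "\<exists>w C. \<forall>n. real (card ({a. \<forall>q\<in>?Q \<inter> {..<w}. \<not> q dvd a} \<inter> {1..n})) \<le> \<eta> / 2 * real n + C"
    using \<eta> by (intro card_sifted_le) auto
  then obtain w C where wC:
    "\<forall>n. real (card ({a. \<forall>q\<in>?Q \<inter> {..<w}. \<not> q dvd a} \<inter> {1..n})) \<le> \<eta> / 2 * real n + C"
    by (elim exE) (rule that)
  \<comment> \<open>The maximum keeps \<open>\<delta>\<close> positive when \<open>w = 0\<close>.\<close>
  define w' where "w' = max 1 w"
  define \<delta> where "\<delta> = 1 / (real w' * (real w' + 1))"
  have \<delta>: "\<delta> > 0" by (simp add: \<delta>_def w'_def)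
  let ?J = "{a. t < psi_ratio a \<and> psi_ratio a < t * (1 + \<delta>)}"
  have "real (card (?J \<inter> {1..n})) \<le> \<eta> * real n + C" for n
  proof -
    let ?X = "{a. \<forall>q\<in>?Q \<inter> {..<w}. \<not> q dvd a} \<inter> {1..n}"
    let ?Y = "{a\<in>{1..n}. \<exists>q>z. q\<^sup>2 dvd a}"
    define Z where "Z = (?J \<inter> {1..n}) - ?X - ?Y"
    have ZD: "a \<in> {1..n}" "t < psi_ratio a" "psi_ratio a < t * (1 + \<delta>)" if "a \<in> Z" for a
      using that by (auto simp: Z_def)
    \<comment> \<open>A prime factor of \<open>a\<close> in the chosen range whose square does not divide \<open>a\<close>.\<close>
    define h where "h = (\<lambda>a. SOME q. prime q \<and> z < q \<and> q < w \<and> q dvd a \<and> \<not> q\<^sup>2 dvd a)"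
    have h: "prime (h a) \<and> z < h a \<and> h a < w \<and> h a dvd a \<and> \<not> (h a)\<^sup>2 dvd a" if "a \<in> Z" for a
    proof -
      have "\<exists>q. prime q \<and> z < q \<and> q < w \<and> q dvd a \<and> \<not> q\<^sup>2 dvd a"
        using that by (auto simp: Z_def)
      thus ?thesis unfolding h_def by (rule someI_ex)
    qed
    have fact: "a div h a > 0 \<and> \<not> h a dvd a div h a \<and> a = (a div h a) * h a \<and> a div h a \<le> n div z
       \<and> psi_ratio a = psi_ratio (a div h a) * (1 + 1 / real (h a))" if a: "a \<in> Z" for a
    proof -
      note ha = h[OF a]
      have eq: "a = (a div h a) * h a" using ha by simp
      have pos: "a div h a > 0" using ZD(1)[OF a] eq by (intro Nat.gr0I) auto
      have nd: "\<not> h a dvd a div h a"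
      proof
        assume "h a dvd a div h a"
        hence "h a * h a dvd (a div h a) * h a" by (rule mult_dvd_mono) simp
        thus False using ha eq by (simp add: power2_eq_square)
      qed
      have "a div h a \<le> n div h a" using ZD[OF a] by (intro div_le_mono) auto
      also have "\<dots> \<le> n div z" using ha z by (intro div_le_mono2) auto
      finally have le: "a div h a \<le> n div z" .
      have "psi_ratio a = psi_ratio (a div h a) * (1 + 1 / real (h a))"
        using psi_ratio_prime_times[OF _ nd pos] ha unfolding eq[symmetric] by simp
      thus ?thesis using eq pos nd le by blast
    qed
    have key: "\<not> h a < h b" if ab: "a \<in> Z" "b \<in> Z" "a div h a = b div h b" for a b
    proof
      assume lt: "h a < h b"
      let ?m = "psi_ratio (a div h a)"
      have "psi_ratio b * (1 + \<delta>) = ?m * ((1 + 1 / real (h b)) * (1 + \<delta>))"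
        using fact[OF ab(2)] ab(3) by simp
      also have "\<dots> \<le> ?m * (1 + 1 / real (h a))"
        unfolding \<delta>_def using lt h[OF ab(1)] h[OF ab(2)] psi_ratio_pos[of "a div h a"]
        by (intro mult_left_mono prime_ratio_gap) (auto simp: w'_def prime_gt_0_nat)
      also have "\<dots> = psi_ratio a" using fact[OF ab(1)] by simp
      also have "\<dots> < t * (1 + \<delta>)" using ZD[OF ab(1)] by simp
      finally have "psi_ratio b < t" using \<delta> by simp
      thus False using ZD[OF ab(2)] by simp
    qed
    have inj: "inj_on (\<lambda>a. a div h a) Z"
    proof (rule inj_onI)
      fix a b assume ab: "a \<in> Z" "b \<in> Z" "a div h a = b div h b"
      have "h a = h b" using key[OF ab] key[OF ab(2) ab(1) ab(3)[symmetric]] by simp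
      thus "a = b" using fact[OF ab(1)] fact[OF ab(2)] ab(3) by metis
    qed
    have "(\<lambda>a. a div h a) ` Z \<subseteq> {1..n div z}" using fact by (force simp: Suc_le_eq)
    hence "card Z \<le> card {1..n div z}" by (intro card_inj_on_le[OF inj]) auto
    hence "real (card Z) \<le> real (n div z)" by simp
    also have "\<dots> \<le> real n / real z" by (rule of_nat_div_le_of_nat)
    finally have Z: "real (card Z) \<le> real n / real z"
      .
    have Y: "real (card ?Y) \<le> real n / real z" by (rule card_large_square_divisor_le) fact
    have "card (?J \<inter> {1..n}) \<le> card (?X \<union> ?Y \<union> Z)"
      by (rule card_mono) (auto simp: Z_def)
    also have "\<dots> \<le> card (?X \<union> ?Y) + card Z" by (rule card_Un_le)
    also have "card (?X \<union> ?Y) \<le> card ?X + card ?Y" by (rule card_Un_le)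
    finally have "real (card (?J \<inter> {1..n})) \<le> real (card ?X) + real (card ?Y) + real (card Z)"
      by (simp only: of_nat_add [symmetric] of_nat_le_iff)
    also have "\<dots> \<le> (\<eta> / 2 * real n + C) + real n * (1 / real z) + real n * (1 / real z)"
      using wC[rule_format, of n] Y Z by simp
    also have "\<dots> \<le> (\<eta> / 2 * real n + C) + real n * (\<eta> / 4) + real n * (\<eta> / 4)"
      using z \<eta> by (intro add_mono mult_left_mono) auto
    also have "\<dots> = \<eta> * real n + C" by (simp add: field_simps)
    finally show ?thesis .
  qed
  with \<delta> show ?thesis by (intro exI[of _ \<delta>] exI[of _ C] conjI allI)
qed

section \<open>Amicable pairs\<close>

lemma dedekind_psi_eq: "dedekind_psi n = real n * psi_ratio n"
  by (simp add: dedekind_psi_def psi_ratio_def)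

lemma prod_prime_factors_dvd_self:
  fixes n :: nat assumes "n > 0"
  shows "\<Prod>(prime_factors n) dvd n"
proof -
  have "\<Prod>(prime_factors n) dvd (\<Prod>p\<in>prime_factors n. p ^ multiplicity p n)"
    by (rule prod_dvd_prod) (auto simp: prime_factors_multiplicity intro!: dvd_power)
  also have "\<dots> = n" using assms prod_prime_factors[of n] by simp
  finally show ?thesis .
qed

text \<open>
  This integral form of \<open>\<psi>\<close> exhibits the divisors \<open>q + 1\<close>.
\<close>

lemma dedekind_psi_eq_nat:
  assumes "n > 0"
  shows "dedekind_psi n = real (n div \<Prod>(prime_factors n) * (\<Prod>p\<in>prime_factors n. p + 1))"
proof -
  have pos: "real p > 0" if "p \<in> prime_factors n" for p
    using that by (auto simp: in_prime_factors_iff prime_gt_0_nat)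
  have "psi_ratio n = (\<Prod>p\<in>prime_factors n. real (p + 1) / real p)"
    unfolding psi_ratio_def using pos by (intro prod.cong) (auto simp: field_simps)
  also have "\<dots> = (\<Prod>p\<in>prime_factors n. real (p + 1)) / (\<Prod>p\<in>prime_factors n. real p)"
    by (rule prod_dividef)
  finally have "psi_ratio n = real (\<Prod>p\<in>prime_factors n. p + 1) / real (\<Prod>(prime_factors n))"
    by simp
  thus ?thesis using prod_prime_factors_dvd_self[OF assms]
    by (simp add: dedekind_psi_eq real_of_nat_div)
qed

text \<open>
  \<open>q + 1\<close>, and with it \<open>p\<close>, divides \<open>\<psi>(a) = a + b\<close>.
\<close>

lemma psi_amicable_dvd_transfer:
  assumes ab: "psi_amicable a b" and p: "p dvd a" and q: "prime q" "p dvd q + 1" "q dvd a"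
  shows "p dvd b"
proof -
  have a: "a > 0" using ab by (simp add: psi_amicable_def)
  have eq: "a + b = a div \<Prod>(prime_factors a) * (\<Prod>p\<in>prime_factors a. p + 1)"
    using ab dedekind_psi_eq_nat[OF a] unfolding psi_amicable_def by (metis of_nat_eq_iff)
  have "q \<in> prime_factors a" using q a by (simp add: in_prime_factors_iff)
  hence "q + 1 dvd (\<Prod>p\<in>prime_factors a. p + 1)" by (intro dvd_prodI) auto
  hence "p dvd a + b" unfolding eq using q(2) by (meson dvd_mult dvd_trans)
  with p show ?thesis by (simp add: dvd_add_right_iff)
qed

text \<open>
  The factor from the primes above \<open>y\<close> is at most the exponential of the sum that
  \<open>card_large_prime_tail_le\<close> controls.
\<close>

lemma psi_ratio_split:
  "psi_ratio a \<le> (\<Prod>p | p \<in> prime_factors a \<and> p \<le> y. 1 + 1 / real p)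
      * exp (\<Sum>p | p \<in> prime_factors a \<and> y < p. 1 / real p)"
proof -
  have "prime_factors a = {p. p \<in> prime_factors a \<and> p \<le> y} \<union> {p. p \<in> prime_factors a \<and> y < p}"
    by auto
  hence "psi_ratio a = (\<Prod>p\<in>{p. p \<in> prime_factors a \<and> p \<le> y} \<union> {p. p \<in> prime_factors a \<and> y < p}. 1 + 1 / real p)"
    unfolding psi_ratio_def by simp
  also have "\<dots> = (\<Prod>p | p \<in> prime_factors a \<and> p \<le> y. 1 + 1 / real p) *
       (\<Prod>p | p \<in> prime_factors a \<and> y < p. 1 + 1 / real p)"
    by (rule prod.union_disjoint) auto
  also have "(\<Prod>p | p \<in> prime_factors a \<and> y < p. 1 + 1 / real p) \<le>
      (\<Prod>p | p \<in> prime_factors a \<and> y < p. exp (1 / real p))"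
    by (intro prod_mono) (auto simp: exp_ge_add_one_self)
  also have "\<dots> = exp (\<Sum>p | p \<in> prime_factors a \<and> y < p. 1 / real p)"
    by (simp add: exp_sum)
  finally show ?thesis by (simp add: mult_left_mono prod_nonneg)
qed

lemma psi_amicable_ratio_bounds:
  assumes ab: "psi_amicable a b" "a < b"
  shows "psi_ratio a > 2" "psi_ratio b < 2"
proof -
  have pos: "real a > 0" "real b > 0" and eq: "real a * psi_ratio a = real a + real b"
      "real b * psi_ratio b = real a + real b"
    using ab by (auto simp: psi_amicable_def dedekind_psi_eq)
  have "real a * 2 < real a * psi_ratio a" "real b * psi_ratio b < real b * 2"
    unfolding eq using ab by simp_all
  thus "psi_ratio a > 2" "psi_ratio b < 2" using pos by simp_all
qed

text \<open>
  An amicable \<open>a\<close> lies in one of three sparse sets: those missing, for some prime \<open>p \<le> y\<close>, a prime factor in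
  the class of -1 modulo \<open>p\<close>; those with a large tail of primes above \<open>y\<close>; and those whose ratio is just above 2. The
  order of choices matters: \<open>\<delta>\<close> depends on \<open>\<eta>\<close>, and \<open>y\<close> on both.
\<close>

theorem psi_amicable_density_zero:
  "density_zero {a. \<exists>b>a. psi_amicable a b}"
  unfolding density_zero_def
proof (intro allI impI)
  fix \<eta> :: real assume \<eta>: "\<eta> > 0"
  note dir = sum_inverse_primes_minus_one_mod
  have "\<not> summable (\<lambda>q. if prime q then 1 / real q else 0)"
  proof
    assume "summable (\<lambda>q. if prime q then 1 / real q else (0::real))"
    hence "summable (\<lambda>q. if prime q \<and> 2 dvd q + 1 then 1 / real q else 0)"
      by (rule summable_comparison_test_ev[rotated]) auto
    with dir[of 2] show False by simp
  qed
  then obtain \<delta> C1 where \<delta>: "\<delta> > 0" and C1: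
    "\<And>n. real (card ({a. 2 < psi_ratio a \<and> psi_ratio a < 2 * (1 + \<delta>)} \<inter> {1..n})) \<le> \<eta> / 3 * real n + C1"
    using psi_ratio_continuous_distribution[of 2 "\<eta> / 3"] \<eta> by auto
  \<comment> \<open>The tail may change the ratio by at most the factor \<open>exp \<epsilon> = 1 + \<delta>\<close>.\<close>
  define \<epsilon> where "\<epsilon> = ln (1 + \<delta>)"
  have \<epsilon>: "\<epsilon> > 0" "exp \<epsilon> = 1 + \<delta>" using \<delta> by (auto simp: \<epsilon>_def)
  obtain y :: nat where y: "y > 0" "1 / (real y * \<epsilon>) < \<eta> / 3"
  proof -
    obtain m where m: "inverse (real (Suc m)) < \<eta> / 3 * \<epsilon>"
      using reals_Archimedean[of "\<eta> / 3 * \<epsilon>"] \<eta> \<epsilon> by auto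
    have "1 / (real (Suc m) * \<epsilon>) = inverse (real (Suc m)) / \<epsilon>" by (simp add: divide_simps)
    also have "\<dots> < \<eta> / 3" using m \<epsilon> by (simp add: pos_divide_less_eq)
    finally show ?thesis by (intro that[of "Suc m"]) auto
  qed
  define E where "E = (\<Union>p\<in>{p. prime p \<and> p \<le> y}. {a. \<forall>q\<in>{q. prime q \<and> p dvd q + 1}. \<not> q dvd a})"
  have "density_zero E"
    unfolding E_def using dir by (intro density_zero_UN density_zero_sifted) auto
  moreover have "\<eta> / 3 > 0" using \<eta> by simp
  ultimately obtain C2 where C2: "\<And>n. real (card (E \<inter> {1..n})) \<le> \<eta> / 3 * real n + C2"
    by (rule density_zeroD) (rule that)
  have "real (card ({a. \<exists>b>a. psi_amicable a b} \<inter> {1..n})) \<le> \<eta> * real n + (C1 + C2)" for n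
  proof -
    let ?J = "{a. 2 < psi_ratio a \<and> psi_ratio a < 2 * (1 + \<delta>)} \<inter> {1..n}"
    let ?T = "{a\<in>{1..n}. \<epsilon> \<le> (\<Sum>p | p \<in> prime_factors a \<and> y < p. 1 / real p)}"
    have "{a. \<exists>b>a. psi_amicable a b} \<inter> {1..n} \<subseteq> (E \<inter> {1..n} \<union> ?T) \<union> ?J"
    proof
      fix a assume "a \<in> {a. \<exists>b>a. psi_amicable a b} \<inter> {1..n}"
      then obtain b where ab: "psi_amicable a b" "a < b" and a: "a \<in> {1..n}" by auto
      show "a \<in> (E \<inter> {1..n} \<union> ?T) \<union> ?J"
      proof (cases "a \<in> E \<or> a \<in> ?T")
        case True
        thus ?thesis using a by blast
      next
        case False
        have tail: "(\<Sum>p | p \<in> prime_factors a \<and> y < p. 1 / real p) < \<epsilon>" using False a by auto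
        let ?S = "{p. p \<in> prime_factors a \<and> p \<le> y}"
        have "?S \<subseteq> prime_factors b"
        proof
          fix p assume p: "p \<in> ?S"
          hence "prime p" "p \<le> y" "p dvd a" by (auto simp: in_prime_factors_iff)
          then obtain q where "prime q" "p dvd q + 1" "q dvd a"
            using False by (auto simp: E_def)
          hence "p dvd b" using psi_amicable_dvd_transfer[OF ab(1) \<open>p dvd a\<close>] by blast
          thus "p \<in> prime_factors b" using \<open>prime p\<close> ab by (simp add: in_prime_factors_iff)
        qed
        hence "(\<Prod>p\<in>?S. 1 + 1 / real p) \<le> psi_ratio b"
          unfolding psi_ratio_def by (intro prod_mono2) auto
        also have "\<dots> < 2" by (rule psi_amicable_ratio_bounds[OF ab])
        finally have "(\<Prod>p\<in>?S. 1 + 1 / real p) < 2" .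
        hence "(\<Prod>p\<in>?S. 1 + 1 / real p) * exp (\<Sum>p | p \<in> prime_factors a \<and> y < p. 1 / real p) < 2 * exp \<epsilon>"
          using tail by (intro mult_strict_mono) auto
        with psi_ratio_split[of a y] have "psi_ratio a < 2 * (1 + \<delta>)" by (simp add: \<epsilon>)
        thus ?thesis using psi_amicable_ratio_bounds[OF ab] a by simp
      qed
    qed
    hence "card ({a. \<exists>b>a. psi_amicable a b} \<inter> {1..n}) \<le> card ((E \<inter> {1..n} \<union> ?T) \<union> ?J)"
      by (rule card_mono[rotated]) auto
    also have "\<dots> \<le> card (E \<inter> {1..n} \<union> ?T) + card ?J" by (rule card_Un_le)
    also have "card (E \<inter> {1..n} \<union> ?T) \<le> card (E \<inter> {1..n}) + card ?T" by (rule card_Un_le)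
    finally have "real (card ({a. \<exists>b>a. psi_amicable a b} \<inter> {1..n})) \<le>
        real (card (E \<inter> {1..n})) + real (card ?T) + real (card ?J)"
      by (simp only: of_nat_add [symmetric] of_nat_le_iff)
    moreover have "real (card ?T) \<le> \<eta> / 3 * real n"
    proof -
      have "real (card ?T) \<le> real n / (real y * \<epsilon>)" by (rule card_large_prime_tail_le) (use y \<epsilon> in auto)
      also have "\<dots> = 1 / (real y * \<epsilon>) * real n" by simp
      also have "\<dots> \<le> \<eta> / 3 * real n" using y by (intro mult_right_mono) auto
      finally show ?thesis .
    qed
    ultimately show ?thesis using C1[of n] C2[of n] by (simp add: field_simps)
  qed
  thus "\<exists>C. \<forall>n. real (card ({a. \<exists>b>a. psi_amicable a b} \<inter> {1..n})) \<le> \<eta> * real n + C"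
    by (intro exI[of _ "C1 + C2"] allI)
qed

lemma psi_amicable_count_eq: "psi_amicable_count n = card ({a. \<exists>b>a. psi_amicable a b} \<inter> {1..n})"
proof -
  define P where "P = {(a, b). psi_amicable a b \<and> a < b \<and> a \<le> n}"
  have "inj_on fst P"
  proof (rule inj_onI)
    fix x y assume xy: "x \<in> P" "y \<in> P" "fst x = fst y"
    have eq: "dedekind_psi (fst z) = real (fst z + snd z)" if "z \<in> P" for z
      using that unfolding P_def psi_amicable_def by (simp add: case_prod_beta)
    have "real (fst x + snd x) = real (fst y + snd y)"
      using eq[OF xy(1)] eq[OF xy(2)] xy(3) by (simp only:)
    hence "snd x = snd y" using xy(3) by (simp only: of_nat_eq_iff add_left_cancel)
    with xy(3) show "x = y" by (rule prod_eqI)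
  qed
  moreover have "fst ` P = {a. \<exists>b>a. psi_amicable a b} \<inter> {1..n}"
  proof (intro equalityI subsetI)
    fix a assume "a \<in> fst ` P"
    then obtain b where b: "psi_amicable a b" "a < b" "a \<le> n" unfolding P_def by auto
    hence "a > 0" by (simp add: psi_amicable_def)
    with b show "a \<in> {a. \<exists>b>a. psi_amicable a b} \<inter> {1..n}" by auto
  next
    fix a assume "a \<in> {a. \<exists>b>a. psi_amicable a b} \<inter> {1..n}"
    then obtain b where "psi_amicable a b" "a < b" "a \<le> n" by auto
    hence "(a, b) \<in> P" unfolding P_def by simp
    thus "a \<in> fst ` P" by (rule image_eqI[rotated]) simp
  qed
  ultimately show ?thesis unfolding psi_amicable_count_def P_def[symmetric] using card_image by fastforce
qed

lemma density_zero_imp_tendsto: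
  assumes "density_zero A"
  shows "(\<lambda>n. real (card (A \<inter> {1..n})) / real n) \<longlonglongrightarrow> 0"
proof (rule LIMSEQ_I)
  fix r :: real assume r: "r > 0"
  have "r / 2 > 0" using r by simp
  obtain C where C: "\<And>n. real (card (A \<inter> {1..n})) \<le> r / 2 * real n + C"
    by (rule density_zeroD[OF assms \<open>r / 2 > 0\<close>]) (rule that)
  obtain N :: nat where N: "real N > 2 * \<bar>C\<bar> / r" using reals_Archimedean2 by blast
  have "norm (real (card (A \<inter> {1..n})) / real n - 0) < r" if "n \<ge> Suc N" for n
  proof -
    have n: "real n > 0" using that by simp
    have "2 * \<bar>C\<bar> / r < real n" using N that by simp
    hence "C < r / 2 * real n" using r by (simp add: field_simps)
    hence "real (card (A \<inter> {1..n})) < r * real n" using C[of n] by (simp add: field_simps)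
    thus ?thesis using n by (simp add: pos_divide_less_eq)
  qed
  thus "\<exists>no. \<forall>n\<ge>no. norm (real (card (A \<inter> {1..n})) / real n - 0) < r" by blast
qed

theorem theorem1:
  shows "(\<lambda>n::nat. real (psi_amicable_count n) / real n) \<longlonglongrightarrow> 0"
  unfolding psi_amicable_count_eq by (rule density_zero_imp_tendsto[OF psi_amicable_density_zero])

end
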